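(* An arrangement consisting of the Dyck quartic and $3$ of its hyperosculating lines intersecting at one ordinary triple point is plus-one generated.
   Context: Work over $\mathbb{C}$. The Dyck quartic is the smooth plane curve $x^4 + y^4 + z^4=0$ in $\mathbb{P}^2_{\mathbb{C}}$. A line is hyperosculating to a smooth plane quartic if it meets the curve in a single point $P$ with multiplicity $4$. An ordinary triple point is a $D_4$ singularity (three smooth branches with pairwise distinct tangents). Let $S=\mathbb{C}[x,y,z]$. For a reduced curve $C: f=0$ of degree $d$ in $\mathbb{P}^2_{\mathbb{C}}$, let $J_f$ be the ideal generated by the partial derivatives of $f$ and $M(f)=S/J_f$ the Milnor algebra. $C$ is an $m$-syzygy curve if $M(f)$ has minimal graded free resolution $$0 \rightarrow \bigoplus_{i=1}^{m-2}S(-e_{i}) \rightarrow \bigoplus_{i=1}^{m}S(1-d - d_{i}) \rightarrow S^{3}(1-d)\rightarrow S \rightarrow M(f) \rightarrow 0$$ with $e_{1} \leq \dots \leq e_{m-2}$ and $1\leq d_{1} \leq \dots \leq d_{m}$. $C$ is plus-one generated (of level $d_3$) if it is a $3$-syzygy curve such that $d_1+d_2=d$ and $d_3>d_2$. An arrangement is called plus-one generated if the reduced curve that is the union of its members is. *)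

theory Defs
  imports
    "HOL-Analysis.Analysis"
    "HOL-Library.Poly_Mapping"
    "HOL-Computational_Algebra.Squarefree"
begin

section \<open>The graded ring \<open>S = \<complex>[x, y, z]\<close>\<close>

text \<open>
  The variables \<open>x, y, z\<close> are indexed by \<open>1, 2, 3\<close> of the three-element type \<open>3\<close> (where \<open>3 = 0\<close>);
  points of the projective plane are represented by nonzero vectors of \<open>\<complex>\<^sup>3\<close> with the same indexing.
\<close>

type_synonym monomial = "3 \<Rightarrow>\<^sub>0 nat"
type_synonym S = "monomial \<Rightarrow>\<^sub>0 complex"

definition var :: "3 \<Rightarrow> S" where
  "var i = Poly_Mapping.single (Poly_Mapping.single i 1) 1"

definition mdegree :: "monomial \<Rightarrow> nat" where
  "mdegree m = (\<Sum>i\<in>UNIV. Poly_Mapping.lookup m i)"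

text \<open>Degrees are integers because of the shifts below; in negative degrees only \<open>0\<close> is homogeneous.\<close>

definition homogeneous :: "int \<Rightarrow> S \<Rightarrow> bool" where
  "homogeneous k f \<longleftrightarrow> (\<forall>m\<in>Poly_Mapping.keys f. int (mdegree m) = k)"

definition partial_deriv :: "3 \<Rightarrow> S \<Rightarrow> S" where
  "partial_deriv i f =
     (\<Sum>m\<in>Poly_Mapping.keys f.
        Poly_Mapping.single (m - Poly_Mapping.single i 1)
          (of_nat (Poly_Mapping.lookup m i) * Poly_Mapping.lookup f m))"

text \<open>Substitution of \<open>v\<close> for the variables, with the coefficients mapped by \<open>h\<close>.\<close>

definition subst_poly :: "(complex \<Rightarrow> 'b::comm_semiring_1) \<Rightarrow> S \<Rightarrow> (3 \<Rightarrow> 'b) \<Rightarrow> 'b" where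
  "subst_poly h f v =
     (\<Sum>m\<in>Poly_Mapping.keys f.
        h (Poly_Mapping.lookup f m) * (\<Prod>i\<in>UNIV. v i ^ Poly_Mapping.lookup m i))"


section \<open>Plane curves\<close>

definition zero_locus :: "S \<Rightarrow> (complex ^ 3) set" where
  "zero_locus f = {P. P \<noteq> 0 \<and> subst_poly id f (\<lambda>i. P $ i) = 0}"

definition same_point :: "complex ^ 3 \<Rightarrow> complex ^ 3 \<Rightarrow> bool" where
  "same_point P Q \<longleftrightarrow> (\<exists>c. c \<noteq> 0 \<and> Q = c *s P)"

definition is_line :: "S \<Rightarrow> bool" where
  "is_line L \<longleftrightarrow> homogeneous 1 L \<and> L \<noteq> 0"

text \<open>
  The intersection multiplicity at \<open>P\<close> of the curve \<open>f = 0\<close> with the line \<open>L\<close> through \<open>P\<close> is the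
  order of vanishing at \<open>t = 0\<close> of \<open>f(P + t Q)\<close>, for any point \<open>Q\<close> of \<open>L\<close> other than \<open>P\<close>.
\<close>

definition restrict_to_line :: "S \<Rightarrow> complex ^ 3 \<Rightarrow> complex ^ 3 \<Rightarrow> complex poly" where
  "restrict_to_line f P Q = subst_poly (\<lambda>c. [:c:]) f (\<lambda>i. [:P $ i, Q $ i:])"

definition meets_with_multiplicity :: "S \<Rightarrow> S \<Rightarrow> complex ^ 3 \<Rightarrow> nat \<Rightarrow> bool" where
  "meets_with_multiplicity f L P k \<longleftrightarrow>
     (\<forall>Q \<in> zero_locus L. \<not> same_point P Q \<longrightarrow> order 0 (restrict_to_line f P Q) = k)"

definition hyperosculating :: "S \<Rightarrow> S \<Rightarrow> bool" where
  "hyperosculating f L \<longleftrightarrow> is_line L \<and>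
     (\<exists>P \<in> zero_locus L \<inter> zero_locus f.
        (\<forall>R \<in> zero_locus L \<inter> zero_locus f. same_point P R) \<and>
        meets_with_multiplicity f L P 4)"

definition dyck_quartic :: S where
  "dyck_quartic = var 1 ^ 4 + var 2 ^ 4 + var 3 ^ 4"

text \<open>
  For a basis \<open>P, Q, R\<close> of \<open>\<complex>\<^sup>3\<close>, the expansion of \<open>f(P + u Q + v R)\<close> in \<open>\<complex>[[u]][[v]]\<close>: the equation
  of the curve in the local coordinates \<open>u, v\<close> at \<open>P\<close>.  The coefficient of \<open>u\<^sup>i v\<^sup>j\<close> in \<open>g\<close> is
  \<open>fps_nth (fps_nth g j) i\<close>.
\<close>

definition local_equation ::
    "S \<Rightarrow> complex ^ 3 \<Rightarrow> complex ^ 3 \<Rightarrow> complex ^ 3 \<Rightarrow> complex fps fps" where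
  "local_equation f P Q R =
     subst_poly (\<lambda>c. fps_const (fps_const c)) f
       (\<lambda>i. fps_const (fps_const (P $ i) + fps_const (Q $ i) * fps_X)
            + fps_const (fps_const (R $ i)) * fps_X)"

definition smooth_branch :: "complex fps fps \<Rightarrow> bool" where
  "smooth_branch g \<longleftrightarrow> fps_nth (fps_nth g 0) 0 = 0 \<and>
     (fps_nth (fps_nth g 0) 1 \<noteq> 0 \<or> fps_nth (fps_nth g 1) 0 \<noteq> 0)"

definition distinct_tangents :: "complex fps fps \<Rightarrow> complex fps fps \<Rightarrow> bool" where
  "distinct_tangents g h \<longleftrightarrow>
     fps_nth (fps_nth g 0) 1 * fps_nth (fps_nth h 1) 0
       \<noteq> fps_nth (fps_nth g 1) 0 * fps_nth (fps_nth h 0) 1"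

text \<open>Three smooth formal branches with pairwise distinct tangents (a \<open>D\<^sub>4\<close> singularity).\<close>

definition ordinary_triple_point :: "S \<Rightarrow> complex ^ 3 \<Rightarrow> bool" where
  "ordinary_triple_point f P \<longleftrightarrow>
     (\<exists>Q R g1 g2 g3.
        det (vector [P, Q, R] :: complex ^ 3 ^ 3) \<noteq> 0 \<and>
        local_equation f P Q R = g1 * g2 * g3 \<and>
        smooth_branch g1 \<and> smooth_branch g2 \<and> smooth_branch g3 \<and>
        distinct_tangents g1 g2 \<and> distinct_tangents g1 g3 \<and> distinct_tangents g2 g3)"


section \<open>The Milnor algebra\<close>

definition jacobian_ideal :: "S \<Rightarrow> S set" where
  "jacobian_ideal f = {(\<Sum>i\<in>UNIV. a i * partial_deriv i f) | a. True}"

definition jacobian_rel :: "S \<Rightarrow> (S \<times> S) set" where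
  "jacobian_rel f = {(g, h). g - h \<in> jacobian_ideal f}"

definition milnor_algebra :: "S \<Rightarrow> S set set" where
  "milnor_algebra f = UNIV // jacobian_rel f"

definition milnor_proj :: "S \<Rightarrow> S \<Rightarrow> S set" where
  "milnor_proj f g = jacobian_rel f `` {g}"


section \<open>Graded free modules and minimal resolutions\<close>

text \<open>
  A list \<open>b = [b\<^sub>0, \<dots>, b\<^sub>n\<^sub>-\<^sub>1]\<close> of shifts stands for the graded module
  \<open>S(b\<^sub>0) \<oplus> \<dots> \<oplus> S(b\<^sub>n\<^sub>-\<^sub>1)\<close>, where \<open>S(b)\<^sub>k = S\<^sub>k\<^sub>+\<^sub>b\<close>.
\<close>

definition free_module :: "int list \<Rightarrow> (nat \<Rightarrow> S) set" where
  "free_module b = {v. \<forall>i \<ge> length b. v i = 0}"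

definition homogeneous_part :: "int list \<Rightarrow> int \<Rightarrow> (nat \<Rightarrow> S) set" where
  "homogeneous_part b k = {v \<in> free_module b. \<forall>i < length b. homogeneous (k + b ! i) (v i)}"

definition graded_hom :: "int list \<Rightarrow> int list \<Rightarrow> ((nat \<Rightarrow> S) \<Rightarrow> (nat \<Rightarrow> S)) \<Rightarrow> bool" where
  "graded_hom b c \<phi> \<longleftrightarrow>
     (\<forall>v \<in> free_module b. \<phi> v \<in> free_module c) \<and>
     (\<forall>v \<in> free_module b. \<forall>w \<in> free_module b. \<phi> (\<lambda>i. v i + w i) = (\<lambda>i. \<phi> v i + \<phi> w i)) \<and>
     (\<forall>a. \<forall>v \<in> free_module b. \<phi> (\<lambda>i. a * v i) = (\<lambda>i. a * \<phi> v i)) \<and>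
     (\<forall>k. \<forall>v \<in> homogeneous_part b k. \<phi> v \<in> homogeneous_part c k)"

text \<open>The image of \<open>\<phi>\<close> lies in \<open>(x, y, z) F\<close>, \<open>F\<close> being the target: all constant terms vanish.\<close>

definition minimal_hom :: "int list \<Rightarrow> ((nat \<Rightarrow> S) \<Rightarrow> (nat \<Rightarrow> S)) \<Rightarrow> bool" where
  "minimal_hom b \<phi> \<longleftrightarrow> (\<forall>v \<in> free_module b. \<forall>i. Poly_Mapping.lookup (\<phi> v i) 0 = 0)"

text \<open>
  \<open>0 \<rightarrow> F\<^sub>3 \<rightarrow> F\<^sub>2 \<rightarrow> F\<^sub>1 \<rightarrow> S \<rightarrow> M(f) \<rightarrow> 0\<close> is a minimal graded free resolution, with maps \<open>\<phi>\<^sub>3, \<phi>\<^sub>2, \<phi>\<^sub>1\<close> and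
  the canonical projection.  The module \<open>S\<close> is \<open>free_module [0]\<close>, an element \<open>v\<close> of which is
  identified with \<open>v 0\<close>.
\<close>

definition minimal_free_resolution_milnor ::
    "S \<Rightarrow> int list \<Rightarrow> int list \<Rightarrow> int list \<Rightarrow> ((nat \<Rightarrow> S) \<Rightarrow> (nat \<Rightarrow> S)) \<Rightarrow>
     ((nat \<Rightarrow> S) \<Rightarrow> (nat \<Rightarrow> S)) \<Rightarrow> ((nat \<Rightarrow> S) \<Rightarrow> (nat \<Rightarrow> S)) \<Rightarrow> bool" where
  "minimal_free_resolution_milnor f b3 b2 b1 \<phi>3 \<phi>2 \<phi>1 \<longleftrightarrow>
     graded_hom b3 b2 \<phi>3 \<and> graded_hom b2 b1 \<phi>2 \<and> graded_hom b1 [0] \<phi>1 \<and>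
     inj_on \<phi>3 (free_module b3) \<and>
     \<phi>3 ` free_module b3 = {v \<in> free_module b2. \<phi>2 v = (\<lambda>_. 0)} \<and>
     \<phi>2 ` free_module b2 = {v \<in> free_module b1. \<phi>1 v = (\<lambda>_. 0)} \<and>
     \<phi>1 ` free_module b1 = {v \<in> free_module [0]. milnor_proj f (v 0) = milnor_proj f 0} \<and>
     (\<lambda>v. milnor_proj f (v 0)) ` free_module [0] = milnor_algebra f \<and>
     minimal_hom b3 \<phi>3 \<and> minimal_hom b2 \<phi>2 \<and> minimal_hom b1 \<phi>1"


section \<open>Syzygy curves\<close>

definition reduced_curve :: "S \<Rightarrow> nat \<Rightarrow> bool" where
  "reduced_curve f d \<longleftrightarrow> d \<ge> 1 \<and> homogeneous (int d) f \<and> squarefree f"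

definition syzygy_curve :: "nat \<Rightarrow> S \<Rightarrow> nat \<Rightarrow> nat list \<Rightarrow> bool" where
  "syzygy_curve m f d ds \<longleftrightarrow>
     reduced_curve f d \<and> m \<ge> 2 \<and> length ds = m \<and> sorted ds \<and> (\<forall>k \<in> set ds. 1 \<le> k) \<and>
     (\<exists>es :: int list. length es = m - 2 \<and> sorted es \<and>
       (\<exists>\<phi>3 \<phi>2 \<phi>1.
          minimal_free_resolution_milnor f
            (map (\<lambda>e. - e) es)
            (map (\<lambda>k. 1 - int d - int k) ds)
            (replicate 3 (1 - int d))
            \<phi>3 \<phi>2 \<phi>1))"

definition plus_one_generated :: "S \<Rightarrow> bool" where
  "plus_one_generated f \<longleftrightarrow>
     (\<exists>d d1 d2 d3. syzygy_curve 3 f d [d1, d2, d3] \<and> d1 + d2 = d \<and> d3 > d2)"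

text \<open>
  The union of the members of an arrangement of distinct irreducible curves, given by their
  equations, is defined by the product of the equations; that this equation is reduced is part
  of \<^const>\<open>plus_one_generated\<close>.
\<close>

definition arrangement_curve :: "S list \<Rightarrow> S" where
  "arrangement_curve Cs = prod_list Cs"

definition plus_one_generated_arrangement :: "S list \<Rightarrow> bool" where
  "plus_one_generated_arrangement Cs \<longleftrightarrow> plus_one_generated (arrangement_curve Cs)"

end

theory Submission
  imports Defs
begin

text \<open>
  Three concurrent hyperosculating lines lie in one of the pencils through a coordinate point; let
  \<open>x\<close> be the coordinate that they do not involve.  Their product \<open>c\<close> divides
  \<open>y\<^sup>4 + z\<^sup>4 = c l\<close>, so the curve is \<open>(x\<^sup>4 + c l) c = 0\<close>.  With the Jacobian
  \<open>h = c\<^sub>z l\<^sub>y - c\<^sub>y l\<^sub>z\<close>, the syzygies are generated in degrees 3, 4, 5, and the single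
  relation \<open>(x\<^sup>3, - h, 7 l)\<close> between the generators reflects that \<open>x\<^sup>3, h, l\<close> is a
  regular sequence.
\<close>

section \<open>Substitution, grading and derivatives in \<open>S\<close>\<close>

text \<open>Factoriality of S is never invoked: every cancellation is by x or by a linear form in y
  and z, and these are prime because each generates the kernel of a substitution of S into itself.
  The lines share a pencil for the following reason. On a hyperosculating line that omits the
  coordinate m, the quartic restricts to the fourth power of that coordinate; comparing these
  restrictions shows that three distinct such lines from more than one pencil have no common point.
  The factor \<open>l\<close> is the hyperosculating line left over in the pencil. Its slope is
  minus the sum of the other three, since T^4 + 1 has no cubic term, and its scale is chosen to make
  \<open>c * l\<close> equal to y^4 + z^4 on the nose. The 7 in the relation is the degree of
  \<open>c^2 * l\<close> in y and z, by which the Euler derivation in y and z multiplies it. The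
  entries of the relation have degrees 3, 2, 1, so that 3 + 3 = 4 + 2 = 5 + 1.\<close>

abbreviation Const :: "complex \<Rightarrow> S" where
  "Const c \<equiv> Poly_Mapping.single 0 c"

lemma poly_mapping_sum_single:
  "f = (\<Sum>m\<in>Poly_Mapping.keys f. Poly_Mapping.single m (Poly_Mapping.lookup f m))"
proof (rule poly_mapping_eqI)
  fix k
  show "Poly_Mapping.lookup f k = Poly_Mapping.lookup
      (\<Sum>m\<in>Poly_Mapping.keys f. Poly_Mapping.single m (Poly_Mapping.lookup f m)) k"
    by (simp add: lookup_sum lookup_single when_def in_keys_iff)
qed

lemma poly_mapping_induct_add [case_names single add]:
  fixes f :: "'a \<Rightarrow>\<^sub>0 'b::comm_monoid_add"
  assumes single: "\<And>m c. P (Poly_Mapping.single m c)"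
    and add: "\<And>f g. P f \<Longrightarrow> P g \<Longrightarrow> P (f + g)"
  shows "P f"
proof -
  have "P (\<Sum>m\<in>A. Poly_Mapping.single m (Poly_Mapping.lookup f m))" if "finite A" for A
    using that
  proof (induction A)
    case empty
    show ?case using single[of undefined 0] by simp
  qed (auto intro: single add)
  then show ?thesis
    by (subst poly_mapping_sum_single) simp
qed

lemma single_eq_Const_mult: "Poly_Mapping.single m c = Const c * (Poly_Mapping.single m 1 :: S)"
  by (simp add: mult_single)

text \<open>Induction over ring expressions, for statements about ring homomorphisms that pass to
  sums and products, such as \<open>dvd_diff_retract\<close>.\<close>

lemma S_induct [case_names Const var add mult]:
  fixes f :: S
  assumes Const: "\<And>c. P (Const c)" and var: "\<And>i. P (var i)"
    and add: "\<And>f g. P f \<Longrightarrow> P g \<Longrightarrow> P (f + g)" and mult: "\<And>f g. P f \<Longrightarrow> P g \<Longrightarrow> P (f * g)"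
  shows "P f"
proof -
  have pow: "P (Poly_Mapping.single (Poly_Mapping.single i n) 1)" for i n
  proof (induction n)
    case 0
    then show ?case using Const[of 1] by simp
  next
    case (Suc n)
    have "(Poly_Mapping.single (Poly_Mapping.single i (Suc n)) 1 :: S)
        = var i * Poly_Mapping.single (Poly_Mapping.single i n) 1"
      by (simp add: var_def mult_single single_add[symmetric])
    then show ?case using mult var Suc by metis
  qed
  have mon: "P (Poly_Mapping.single m 1)" for m :: monomial
  proof (induction m rule: poly_mapping_induct_add)
    case (add f g)
    have "(Poly_Mapping.single (f + g) 1 :: S) = Poly_Mapping.single f 1 * Poly_Mapping.single g 1"
      by (simp add: mult_single)
    with add mult show ?case by metis
  qed (rule pow)
  show ?thesis
  proof (induction f rule: poly_mapping_induct_add)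
    case (single m c)
    then show ?case by (subst single_eq_Const_mult) (intro mult Const mon)
  qed (rule add)
qed

text \<open>Three instances are needed: evaluation at a point, substitution of polynomials into
  polynomials, and restriction to a parametrized line.\<close>

locale coeff_hom =
  fixes h :: "complex \<Rightarrow> 'b::comm_ring_1"
  assumes hom_add: "h (a + b) = h a + h b"
    and hom_mult: "h (a * b) = h a * h b"
    and hom_one: "h 1 = 1"
begin

lemma hom_zero: "h 0 = 0"
  using hom_add[of 0 0] by simp

text \<open>Terms can cancel in a sum, so additivity is proved over a common finite set containing
  both supports.\<close>

lemma subst_poly_superset:
  assumes "finite A" "Poly_Mapping.keys f \<subseteq> A"
  shows "subst_poly h f v =
    (\<Sum>m\<in>A. h (Poly_Mapping.lookup f m) * (\<Prod>i\<in>UNIV. v i ^ Poly_Mapping.lookup m i))"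
  unfolding subst_poly_def using assms
  by (intro sum.mono_neutral_left) (auto simp: hom_zero in_keys_iff)

lemma subst_single:
  "subst_poly h (Poly_Mapping.single m c) v = h c * (\<Prod>i\<in>UNIV. v i ^ Poly_Mapping.lookup m i)"
  by (subst subst_poly_superset[of "{m}"]) auto

lemma subst_add: "subst_poly h (f + g) v = subst_poly h f v + subst_poly h g v"
proof -
  let ?A = "Poly_Mapping.keys f \<union> Poly_Mapping.keys g"
  have "Poly_Mapping.keys (f + g) \<subseteq> ?A"
    by (rule keys_add)
  then show ?thesis
    by (simp add: subst_poly_superset[of ?A] lookup_add hom_add distrib_right sum.distrib)
qed

lemma subst_mult: "subst_poly h (f * g) v = subst_poly h f v * subst_poly h g v"
proof (induction f rule: poly_mapping_induct_add)
  case (single m c)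
  show ?case
  proof (induction g rule: poly_mapping_induct_add)
    case (single m' c')
    then show ?case
      by (simp add: mult_single subst_single hom_mult lookup_add power_add prod.distrib)
  qed (simp add: distrib_left subst_add)
qed (simp add: distrib_right subst_add)

lemma subst_Const: "subst_poly h (Const c) v = h c"
  by (simp add: subst_single)

lemma subst_zero: "subst_poly h 0 v = 0"
  using subst_Const[of 0] by (simp add: hom_zero)

lemma subst_one: "subst_poly h 1 v = 1"
  using subst_Const[of 1] by (simp add: hom_one)

lemma subst_var: "subst_poly h (var i) v = v i"
proof -
  have "(\<Prod>j\<in>UNIV. v j ^ Poly_Mapping.lookup (Poly_Mapping.single i 1) j)
      = (\<Prod>j\<in>UNIV. if j = i then v j else 1)"
    by (intro prod.cong) (auto simp: lookup_single)
  then show ?thesis by (simp add: var_def subst_single hom_one)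
qed

lemma subst_uminus: "subst_poly h (- f) v = - subst_poly h f v"
  using subst_add[of f "- f" v] by (simp add: subst_zero add_eq_0_iff)

lemma subst_diff: "subst_poly h (f - g) v = subst_poly h f v - subst_poly h g v"
  using subst_add[of f "- g" v] by (simp add: subst_uminus)

lemma subst_power: "subst_poly h (f ^ n) v = subst_poly h f v ^ n"
  by (induction n) (simp_all add: subst_one subst_mult)

lemma subst_numeral: "subst_poly h (numeral n) v = numeral n"
proof -
  have "h (of_nat k) = of_nat k" for k
    by (induction k) (simp_all add: hom_zero hom_one hom_add)
  from this[of "numeral n"] show ?thesis
    using subst_Const[of "numeral n"] by simp
qed

lemmas subst_simps = subst_add subst_mult subst_Const subst_zero subst_one subst_var
  subst_uminus subst_diff subst_power subst_numeral

end

definition poly_eval :: "S \<Rightarrow> (3 \<Rightarrow> complex) \<Rightarrow> complex" where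
  "poly_eval f v = subst_poly id f v"

interpretation eval: coeff_hom "id :: complex \<Rightarrow> complex"
  by unfold_locales simp_all

interpretation subst: coeff_hom "Const"
  by unfold_locales (simp_all add: single_add mult_single)

interpretation restrict: coeff_hom "\<lambda>c::complex. [:c:]"
  by unfold_locales simp_all

lemmas poly_eval_simps = eval.subst_simps[folded poly_eval_def, simplified]

lemma poly_eval_dvd:
  assumes "f dvd g" "poly_eval f v = 0"
  shows "poly_eval g v = 0"
  using assms by (auto simp: poly_eval_simps)

lemma poly_eval_0: "poly_eval f (\<lambda>_. 0) = Poly_Mapping.lookup f 0"
proof (induction f rule: poly_mapping_induct_add)
  case (single m c)
  show ?case
  proof (cases "m = 0")
    case False
    then obtain i where "Poly_Mapping.lookup m i \<noteq> 0"
      by (metis lookup_zero poly_mapping_eqI)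
    then have "(\<Prod>i\<in>UNIV. (0::complex) ^ Poly_Mapping.lookup m i) = 0"
      by (intro prod_zero) auto
    then show ?thesis using False by (simp add: poly_eval_def eval.subst_single lookup_single)
  qed (simp add: poly_eval_def eval.subst_single)
qed (simp add: poly_eval_simps lookup_add)

section \<open>Homogeneous polynomials\<close>

lemma homogeneous_0 [simp]: "homogeneous k 0"
  by (simp add: homogeneous_def)

lemma homogeneous_add: "homogeneous k f \<Longrightarrow> homogeneous k g \<Longrightarrow> homogeneous k (f + g)"
  unfolding homogeneous_def using keys_add[of f g] by blast

lemma homogeneous_sum: "(\<And>a. a \<in> A \<Longrightarrow> homogeneous k (f a)) \<Longrightarrow> homogeneous k (sum f A)"
  by (induction A rule: infinite_finite_induct) (auto intro: homogeneous_add)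

lemma homogeneous_uminus: "homogeneous k f \<Longrightarrow> homogeneous k (- f)"
  unfolding homogeneous_def by (auto simp: in_keys_iff)

lemma homogeneous_diff: "homogeneous k f \<Longrightarrow> homogeneous k g \<Longrightarrow> homogeneous k (f - g)"
  using homogeneous_add[of k f "- g"] homogeneous_uminus by simp

lemma mdegree_add: "mdegree (m + n) = mdegree m + mdegree n"
  by (simp add: mdegree_def lookup_add sum.distrib)

lemma homogeneous_mult:
  assumes "homogeneous k f" "homogeneous l g"
  shows "homogeneous (k + l) (f * g)"
  unfolding homogeneous_def
proof
  fix m assume "m \<in> Poly_Mapping.keys (f * g)"
  then obtain a b where "a \<in> Poly_Mapping.keys f" "b \<in> Poly_Mapping.keys g" "m = a + b"
    using keys_mult[of f g] by blast
  then show "int (mdegree m) = k + l"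
    using assms by (simp add: homogeneous_def mdegree_add)
qed

lemma homogeneous_Const: "homogeneous 0 (Const c)"
  by (simp add: homogeneous_def mdegree_def)

lemma homogeneous_numeral: "homogeneous 0 (numeral n)"
  using homogeneous_Const[of "numeral n"] by simp

lemma mdegree_single: "mdegree (Poly_Mapping.single i n) = n"
proof -
  have "(\<Sum>j\<in>UNIV. Poly_Mapping.lookup (Poly_Mapping.single i n) j) = (\<Sum>j\<in>UNIV. if j = i then n else 0)"
    by (intro sum.cong) (auto simp: lookup_single)
  then show ?thesis by (simp add: mdegree_def)
qed

lemma homogeneous_var: "homogeneous 1 (var i)"
  by (simp add: homogeneous_def var_def mdegree_single)

lemma homogeneous_power: "homogeneous k f \<Longrightarrow> homogeneous (int n * k) (f ^ n)"
proof (induction n)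
  case 0
  then show ?case using homogeneous_Const[of 1] by simp
next
  case (Suc n)
  then have "homogeneous (k + int n * k) (f * f ^ n)"
    by (intro homogeneous_mult) auto
  then show ?case by (simp add: algebra_simps)
qed

lemma mdegree_1_iff: "mdegree m = 1 \<longleftrightarrow> (\<exists>i. m = Poly_Mapping.single i 1)"
proof
  assume "mdegree m = 1"
  then obtain i where i: "Poly_Mapping.lookup m i = 1" "\<And>j. j \<noteq> i \<Longrightarrow> Poly_Mapping.lookup m j = 0"
    unfolding mdegree_def by (subst (asm) sum_eq_1_iff) auto
  have "m = Poly_Mapping.single i 1"
    by (rule poly_mapping_eqI) (metis i lookup_single_eq lookup_single_not_eq)
  then show "\<exists>i. m = Poly_Mapping.single i 1" by blast
qed (auto simp: mdegree_single)

lemma homogeneous_1_eq: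
  assumes "homogeneous 1 f"
  shows "f = (\<Sum>i\<in>UNIV. Const (Poly_Mapping.lookup f (Poly_Mapping.single i 1)) * var i)"
proof -
  let ?s = "\<lambda>i. Poly_Mapping.single i (1::nat) :: monomial"
  have inj: "inj ?s"
    by (rule injI) (metis lookup_single_eq lookup_single_not_eq zero_neq_one)
  have "Poly_Mapping.keys f \<subseteq> range ?s"
    using assms mdegree_1_iff by (auto simp: homogeneous_def)
  then have "f = (\<Sum>m\<in>range ?s. Poly_Mapping.single m (Poly_Mapping.lookup f m))"
    by (subst poly_mapping_sum_single, intro sum.mono_neutral_left) (auto simp: in_keys_iff)
  also have "\<dots> = (\<Sum>i\<in>UNIV. Const (Poly_Mapping.lookup f (?s i)) * var i)"
    using inj by (simp add: sum.reindex var_def mult_single)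
  finally show ?thesis .
qed

section \<open>Partial derivatives\<close>

lemma partial_deriv_superset:
  assumes "finite A" "Poly_Mapping.keys f \<subseteq> A"
  shows "partial_deriv i f = (\<Sum>m\<in>A. Poly_Mapping.single (m - Poly_Mapping.single i 1)
          (of_nat (Poly_Mapping.lookup m i) * Poly_Mapping.lookup f m))"
  unfolding partial_deriv_def using assms
  by (intro sum.mono_neutral_left) (auto simp: in_keys_iff)

lemma partial_deriv_single:
  "partial_deriv i (Poly_Mapping.single m c) =
    Poly_Mapping.single (m - Poly_Mapping.single i 1) (of_nat (Poly_Mapping.lookup m i) * c)"
  by (subst partial_deriv_superset[of "{m}"]) auto

lemma partial_deriv_add: "partial_deriv i (f + g) = partial_deriv i f + partial_deriv i g"
proof -
  let ?A = "Poly_Mapping.keys f \<union> Poly_Mapping.keys g"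
  have "Poly_Mapping.keys (f + g) \<subseteq> ?A"
    by (rule keys_add)
  then show ?thesis
    by (simp add: partial_deriv_superset[of ?A] lookup_add distrib_left single_add sum.distrib)
qed

text \<open>Subtraction of exponents is truncated, so the variable has to occur in m. In the Leibniz
  rule the remaining case carries the coefficient zero.\<close>

lemma minus_single_add:
  assumes "Poly_Mapping.lookup (m :: monomial) i \<noteq> 0"
  shows "m - Poly_Mapping.single i 1 + n = m + n - Poly_Mapping.single i 1"
  using assms
  by (intro poly_mapping_eqI) (auto simp: lookup_add lookup_minus lookup_single when_def)

lemma partial_deriv_mult:
  "partial_deriv i (f * g) = partial_deriv i f * g + f * partial_deriv i g"
proof (induction f rule: poly_mapping_induct_add)
  case (single m c)
  show ?case
  proof (induction g rule: poly_mapping_induct_add)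
    case (single n d)
    show ?case
      using minus_single_add[of m i n] minus_single_add[of n i m]
      by (cases "Poly_Mapping.lookup m i = 0"; cases "Poly_Mapping.lookup n i = 0")
        (simp_all add: mult_single partial_deriv_single lookup_add add.commute
          single_add[symmetric] algebra_simps)
  qed (simp add: distrib_left partial_deriv_add)
qed (simp add: distrib_right partial_deriv_add)

lemma partial_deriv_Const: "partial_deriv i (Const c) = 0"
  by (simp add: partial_deriv_single)

lemma partial_deriv_numeral: "partial_deriv i (numeral n) = 0"
  using partial_deriv_Const[of i "numeral n"] by simp

lemma partial_deriv_var: "partial_deriv i (var j) = (if i = j then 1 else 0)"
  by (auto simp: var_def partial_deriv_single lookup_single)

lemma partial_deriv_power: "partial_deriv i (f ^ n) = of_nat n * f ^ (n - 1) * partial_deriv i f"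
proof (induction n)
  case 0
  show ?case using partial_deriv_Const[of i 1] by simp
next
  case (Suc n)
  then show ?case
    by (cases n) (simp_all add: partial_deriv_mult algebra_simps)
qed

lemmas partial_deriv_simps = partial_deriv_add partial_deriv_mult partial_deriv_Const
  partial_deriv_numeral partial_deriv_var partial_deriv_power

lemma homogeneous_partial_deriv:
  assumes "homogeneous k f"
  shows "homogeneous (k - 1) (partial_deriv i f)"
  unfolding partial_deriv_def
proof -
  have *: "homogeneous (k - 1) (Poly_Mapping.single (m - Poly_Mapping.single i 1)
          (of_nat (Poly_Mapping.lookup m i) * Poly_Mapping.lookup f m))"
    if "m \<in> Poly_Mapping.keys f" for m
  proof (cases "Poly_Mapping.lookup m i = 0")
    case False
    then have "m = m - Poly_Mapping.single i 1 + Poly_Mapping.single i 1"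
      by (intro poly_mapping_eqI) (auto simp: lookup_add lookup_minus lookup_single when_def)
    then have "mdegree m = mdegree (m - Poly_Mapping.single i 1) + 1"
      by (metis mdegree_add mdegree_single)
    then show ?thesis using that assms by (auto simp: homogeneous_def)
  qed simp
  then show "homogeneous (k - 1) (\<Sum>m\<in>Poly_Mapping.keys f.
        Poly_Mapping.single (m - Poly_Mapping.single i 1)
          (of_nat (Poly_Mapping.lookup m i) * Poly_Mapping.lookup f m))"
    by (rule homogeneous_sum)
qed

section \<open>Linear primes and the curve \<open>(x\<^sup>4 + c l) c = 0\<close>\<close>

lemma prime_elem_power_dvd_mult:
  fixes p :: "'a::idom"
  assumes "prime_elem p" "\<not> p dvd b" "p ^ n dvd a * b"
  shows "p ^ n dvd a"
  using assms(3)
proof (induction n arbitrary: a)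
  case (Suc n)
  have "p dvd a * b"
    using Suc.prems by (metis dvd_mult_left power_Suc)
  then obtain a' where a': "a = p * a'"
    using assms(1,2) by (auto simp: prime_elem_dvd_mult_iff)
  have "p ^ n dvd a' * b"
    using Suc.prems prime_elem_not_zeroI[OF assms(1)] by (simp add: a' mult.assoc)
  then have "p ^ n dvd a'"
    by (rule Suc.IH)
  then show ?case
    unfolding a' power_Suc by (rule mult_dvd_mono[OF dvd_refl])
qed simp

text \<open>Each prime in turn is pulled out of \<open>a\<close> and cancelled, so the product is
  assembled without any coprimality argument.\<close>

lemma prime_triple_dvd_mult:
  fixes p1 p2 p3 :: "'a::idom"
  assumes "prime_elem p1" "prime_elem p2" "prime_elem p3"
    and "\<not> p1 dvd b" "\<not> p2 dvd b" "\<not> p3 dvd b" and dvd: "p1 * p2 * p3 dvd a * b"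
  shows "p1 * p2 * p3 dvd a"
proof -
  have p0: "p1 \<noteq> 0" "p2 \<noteq> 0" "p3 \<noteq> 0"
    using assms(1-3) by (blast dest: prime_elem_not_zeroI)+
  have "p1 dvd a * b"
    using dvd by (metis dvd_mult_left mult.assoc)
  then obtain a1 where a1: "a = p1 * a1"
    using assms by (auto simp: prime_elem_dvd_mult_iff)
  have d1: "p2 * p3 dvd a1 * b"
    using dvd p0 by (simp add: a1 mult.assoc)
  then have "p2 dvd a1 * b"
    by (metis dvd_mult_left)
  then obtain a2 where a2: "a1 = p2 * a2"
    using assms by (auto simp: prime_elem_dvd_mult_iff)
  have "p3 dvd a2 * b"
    using d1 p0 by (simp add: a2 mult.assoc)
  then have "p3 dvd a2"
    using assms by (auto simp: prime_elem_dvd_mult_iff)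
  then show ?thesis
    by (simp add: a1 a2 mult.assoc mult_dvd_mono)
qed

section \<open>Unit constants and linear primes of S\<close>

lemma Const_mult_inverse: "c \<noteq> 0 \<Longrightarrow> Const c * Const (inverse c) = 1"
  by (simp add: mult_single)

lemma Const_mult_dvd_iff:
  assumes "c \<noteq> 0"
  shows "Const c * f dvd g \<longleftrightarrow> f dvd g"
proof
  assume "f dvd g"
  then obtain r where "g = f * r" ..
  then have "g = Const c * f * (Const (inverse c) * r)"
    using Const_mult_inverse[OF assms] by (simp add: algebra_simps)
  then show "Const c * f dvd g" ..
qed (auto dest: dvd_mult_right)

lemma numeral_mult_Const_inverse: "numeral n * (Const (inverse (numeral n)) * f) = f"
  using Const_mult_inverse[of "numeral n"] by (simp flip: mult.assoc)

lemma dvd_numeral_multD: "g dvd numeral n * f \<Longrightarrow> g dvd (f :: S)"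
  by (metis dvd_mult mult.left_commute numeral_mult_Const_inverse)

lemma prime_elem_Const_mult:
  assumes "c \<noteq> 0" "prime_elem f"
  shows "prime_elem (Const c * f)"
proof -
  have "Const c \<noteq> 0"
    using Const_mult_inverse[OF assms(1)] by auto
  then show ?thesis using assms by (simp add: prime_elem_def Const_mult_dvd_iff)
qed

text \<open>If g does not involve the variable i, this is the quotient map modulo
  \<open>var i - g\<close>, with the quotient realized inside S as the polynomials in the other
  variables.\<close>

definition retract :: "3 \<Rightarrow> S \<Rightarrow> S \<Rightarrow> S" where
  "retract i g f = subst_poly Const f (\<lambda>n. if n = i then g else var n)"

lemmas retract_simps = subst.subst_simps[where v = "\<lambda>n. if n = i then g else var n" for i g,
  folded retract_def]

text \<open>Substitution replaces the variable by something congruent to it modulo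
  \<open>var i - g\<close>.\<close>

lemma dvd_diff_retract: "var i - g dvd f - retract i g f"
proof (induction f rule: S_induct)
  case (add f f')
  have "f + f' - retract i g (f + f') = (f - retract i g f) + (f' - retract i g f')"
    by (simp add: retract_simps)
  then show ?case using add by (metis dvd_add)
next
  case (mult f f')
  have "f * f' - retract i g (f * f') =
      f * (f' - retract i g f') + retract i g f' * (f - retract i g f)"
    by (simp add: retract_simps algebra_simps)
  then show ?case using mult by (metis dvd_add dvd_mult)
qed (auto simp: retract_simps)

text \<open>The multiples of \<open>var i - g\<close> are the kernel of a ring homomorphism into the
  domain S. The first assumption puts \<open>var i - g\<close> itself into the kernel.\<close>

lemma prime_elem_var_diff:
  assumes "retract i g g = g" "var i \<noteq> g"
  shows "prime_elem (var i - g)"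
proof -
  have iff: "var i - g dvd f \<longleftrightarrow> retract i g f = 0" for f
  proof
    assume "var i - g dvd f"
    then show "retract i g f = 0"
      using assms(1) by (auto simp: retract_simps)
  next
    assume "retract i g f = 0"
    then show "var i - g dvd f" using dvd_diff_retract[of i g f] by simp
  qed
  show ?thesis
    using assms(2) unfolding prime_elem_def iff by (simp add: retract_simps)
qed

text \<open>The resolution is computed for any four distinct lines of a pencil. The scales allow the
  equations of the given lines to be taken as they are.\<close>

locale concurrent_lines =
  fixes i j k :: 3 and a1 a2 a3 a4 t1 t2 t3 t4 :: complex
  assumes ijk: "i \<noteq> j" "i \<noteq> k" "j \<noteq> k"
    and scale_nonzero: "a1 \<noteq> 0" "a2 \<noteq> 0" "a3 \<noteq> 0" "a4 \<noteq> 0"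
    and distinct_slopes: "distinct [t1, t2, t3, t4]"
begin

definition "x = var i"
definition "y = var j"
definition "z = var k"

definition form :: "complex \<Rightarrow> complex \<Rightarrow> S" where
  "form a t = Const a * (y + Const t * z)"

definition "c = form a1 t1 * form a2 t2 * form a3 t3"
definition "l = form a4 t4"
definition "f = (x ^ 4 + c * l) * c"
definition "cy = partial_deriv j c"
definition "cz = partial_deriv k c"
definition "ly = Const a4"
definition "lz = Const (a4 * t4)"

definition "h = cz * ly - cy * lz"

definition pt :: "complex \<Rightarrow> complex \<Rightarrow> complex \<Rightarrow> 3 \<Rightarrow> complex" where
  "pt u v w n = (if n = i then u else if n = j then v else w)"

lemma eval_vars [simp]: "poly_eval x (pt u v w) = u" "poly_eval y (pt u v w) = v"
  "poly_eval z (pt u v w) = w"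
  using ijk by (auto simp: x_def y_def z_def poly_eval_simps pt_def)

lemma eval_form [simp]: "poly_eval (form a t) (pt u v w) = a * (v + t * w)"
  by (simp add: form_def poly_eval_simps)

lemma partial_deriv_x [simp]: "partial_deriv i x = 1" "partial_deriv j x = 0" "partial_deriv k x = 0"
  and partial_deriv_y [simp]: "partial_deriv i y = 0" "partial_deriv j y = 1" "partial_deriv k y = 0"
  and partial_deriv_z [simp]: "partial_deriv i z = 0" "partial_deriv j z = 0" "partial_deriv k z = 1"
  using ijk by (auto simp: x_def y_def z_def partial_deriv_var)

lemma partial_deriv_form [simp]: "partial_deriv i (form a t) = 0"
  "partial_deriv j (form a t) = Const a" "partial_deriv k (form a t) = Const (a * t)"
  by (simp_all add: form_def partial_deriv_simps mult_single)

lemma cy_eq: "cy = Const a1 * form a2 t2 * form a3 t3 + form a1 t1 * Const a2 * form a3 t3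
    + form a1 t1 * form a2 t2 * Const a3"
  by (simp add: cy_def c_def partial_deriv_simps algebra_simps)

lemma cz_eq: "cz = Const (a1 * t1) * form a2 t2 * form a3 t3
    + form a1 t1 * Const (a2 * t2) * form a3 t3 + form a1 t1 * form a2 t2 * Const (a3 * t3)"
  by (simp add: cz_def c_def partial_deriv_simps algebra_simps)

lemma form_euler: "y * Const a + z * Const (a * t) = form a t"
proof -
  have "Const (a * t) = Const a * Const t" by (simp add: mult_single)
  then show ?thesis by (simp add: form_def algebra_simps)
qed

lemma euler_c: "y * cy + z * cz = 3 * c"
proof -
  have "y * cy + z * cz = (y * Const a1 + z * Const (a1 * t1)) * form a2 t2 * form a3 t3
    + (y * Const a2 + z * Const (a2 * t2)) * form a1 t1 * form a3 t3
    + (y * Const a3 + z * Const (a3 * t3)) * form a1 t1 * form a2 t2"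
    unfolding cy_eq cz_eq by (simp add: algebra_simps)
  then show ?thesis by (simp add: form_euler c_def)
qed

lemma euler_l: "y * ly + z * lz = l"
  by (simp add: ly_def lz_def l_def form_euler)

lemma partial_deriv_f:
  "partial_deriv i f = 4 * x ^ 3 * c"
  "partial_deriv j f = cy * (x ^ 4 + 2 * c * l) + c ^ 2 * ly"
  "partial_deriv k f = cz * (x ^ 4 + 2 * c * l) + c ^ 2 * lz"
proof -
  have ci: "partial_deriv i c = 0" by (simp add: c_def partial_deriv_mult)
  have li: "partial_deriv i l = 0" "partial_deriv j l = ly" "partial_deriv k l = lz"
    by (simp_all add: l_def ly_def lz_def)
  show "partial_deriv i f = 4 * x ^ 3 * c"
    by (simp add: f_def partial_deriv_simps ci li)
  show "partial_deriv j f = cy * (x ^ 4 + 2 * c * l) + c ^ 2 * ly"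
    by (simp add: f_def partial_deriv_simps li cy_def algebra_simps power2_eq_square)
  show "partial_deriv k f = cz * (x ^ 4 + 2 * c * l) + c ^ 2 * lz"
    by (simp add: f_def partial_deriv_simps li cz_def algebra_simps power2_eq_square)
qed

lemma prime_x: "prime_elem x"
proof -
  have "x \<noteq> 0"
  proof
    assume "x = 0"
    then have "poly_eval x (pt 1 0 0) = poly_eval 0 (pt 1 0 0)" by simp
    then show False by (simp add: poly_eval_simps)
  qed
  then show ?thesis
    using prime_elem_var_diff[of i 0] by (auto simp: x_def retract_simps)
qed

lemma retract_j_z: "retract j (- (Const t * z)) z = z"
  using ijk by (simp add: z_def retract_simps)

lemma prime_form: "a \<noteq> 0 \<Longrightarrow> prime_elem (form a t)"
proof -
  assume a: "a \<noteq> 0"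
  have "y \<noteq> - (Const t * z)"
  proof
    assume "y = - (Const t * z)"
    then have "poly_eval y (pt 0 1 0) = poly_eval (- (Const t * z)) (pt 0 1 0)" by simp
    then show False by (simp add: poly_eval_simps)
  qed
  then have "prime_elem (y + Const t * z)"
    using prime_elem_var_diff[of j "- (Const t * z)"]
    by (simp add: y_def retract_simps retract_j_z)
  then show ?thesis using a by (simp add: form_def prime_elem_Const_mult)
qed

lemma slopes: "t1 \<noteq> t2" "t1 \<noteq> t3" "t1 \<noteq> t4" "t2 \<noteq> t3" "t2 \<noteq> t4" "t3 \<noteq> t4"
  "t2 \<noteq> t1" "t3 \<noteq> t1" "t4 \<noteq> t1" "t3 \<noteq> t2" "t4 \<noteq> t2" "t4 \<noteq> t3"
  using distinct_slopes by auto

text \<open>The point (u, -t, 1) lies on the line for every u, so one nonzero value there refutes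
  divisibility. Taking u = 1 keeps x away from zero.\<close>

lemma not_form_dvdI: "poly_eval g (pt u (- t) 1) \<noteq> 0 \<Longrightarrow> \<not> form a t dvd g"
  using poly_eval_dvd[of "form a t" g "pt u (- t) 1"] by auto

lemma not_x_dvdI: "poly_eval g (pt 0 v w) \<noteq> 0 \<Longrightarrow> \<not> x dvd g"
  using poly_eval_dvd[of x g "pt 0 v w"] by auto

lemma not_x_dvd: "\<not> x dvd c" "\<not> x dvd l" "\<not> x dvd f"
  using scale_nonzero
  by (auto intro!: not_x_dvdI[of _ 1 0] simp: c_def l_def f_def poly_eval_simps)

lemma c_nonzero: "c \<noteq> 0" and x_nonzero: "x \<noteq> 0"
  using not_x_dvd prime_x by (auto simp: prime_elem_def)

lemma c_dvd_cancel:
  assumes "c dvd g * r" "\<not> form a1 t1 dvd r" "\<not> form a2 t2 dvd r" "\<not> form a3 t3 dvd r"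
  shows "c dvd g"
  using assms prime_triple_dvd_mult prime_form scale_nonzero unfolding c_def by blast

text \<open>On one of the three lines only one summand of \<open>cy\<close> survives, a constant
  times the two other forms, and these do not vanish since the slopes differ.\<close>

lemma form_not_dvd_cy: "\<not> form a1 t1 dvd cy" "\<not> form a2 t2 dvd cy" "\<not> form a3 t3 dvd cy"
  using scale_nonzero slopes
  by (auto intro!: not_form_dvdI simp: cy_eq poly_eval_simps)

lemma cy_nonzero: "cy \<noteq> 0"
  using form_not_dvd_cy by auto

lemma c_dvd_mult_cy: "c dvd g * cy \<Longrightarrow> c dvd g"
  using c_dvd_cancel form_not_dvd_cy by blast

lemma c_dvd_mult_x: "c dvd g * x ^ n \<Longrightarrow> c dvd g"
  by (erule c_dvd_cancel) (auto intro!: not_form_dvdI[of _ 1] simp: poly_eval_simps)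

text \<open>By Euler's formula for \<open>c\<close>, \<open>h = 3 a\<^sub>4 c\<close> at the point where \<open>x\<close> and \<open>l\<close> vanish and \<open>z = 1\<close>.\<close>

lemma not_x_dvd_h: "\<not> x dvd h"
  and not_x_dvd_retract_h: "\<not> x dvd retract j (- (Const t4 * z)) h"
proof -
  let ?P = "pt 0 (- t4) 1"
  have "poly_eval h ?P = 3 * a1 * a2 * a3 * a4 * (t1 - t4) * (t2 - t4) * (t3 - t4)"
    by (simp add: h_def cy_eq cz_eq ly_def lz_def poly_eval_simps algebra_simps)
  then have h: "poly_eval h ?P \<noteq> 0"
    using scale_nonzero slopes by simp
  then show "\<not> x dvd h"
    by (rule not_x_dvdI)
  \<comment> \<open>The difference is a multiple of \<open>y + Const t4 * z\<close>, which vanishes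
    at this point, so the retraction of \<open>h\<close> has the same nonzero value there as
    \<open>h\<close>.\<close>
  have "poly_eval (h - retract j (- (Const t4 * z)) h) ?P = 0"
    by (rule poly_eval_dvd[OF dvd_diff_retract]) (simp add: poly_eval_simps flip: y_def)
  then show "\<not> x dvd retract j (- (Const t4 * z)) h"
    using h by (intro not_x_dvdI) (simp add: poly_eval_simps)
qed

text \<open>Modulo \<open>x^3\<close> the pair (7 l, h) has only the Koszul syzygy (h, -7 l). The
  retraction onto the line l = 0 kills \<open>l\<close> and fixes x, which leaves \<open>x^3\<close>
  dividing \<psi>(v) \<psi>(h), and x does not divide \<psi>(h).\<close>

lemma syzygy_l_h_mod_x3:
  assumes "7 * u * l + v * h = x ^ 3 * w"
  obtains g p r where "u = g * h + x ^ 3 * p" "v = - 7 * g * l + x ^ 3 * r"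
proof -
  define \<psi> where "\<psi> = retract j (- (Const t4 * z))"
  have "\<psi> l = 0" "\<psi> x = x"
    using ijk by (auto simp: \<psi>_def l_def form_def x_def y_def retract_simps retract_j_z)
  then have "\<psi> v * \<psi> h = x ^ 3 * \<psi> w"
    using arg_cong[OF assms, of \<psi>] by (simp add: \<psi>_def retract_simps)
  then have "x ^ 3 dvd \<psi> v * \<psi> h"
    by simp
  then have "x ^ 3 dvd \<psi> v"
    using prime_x not_x_dvd_retract_h prime_elem_power_dvd_mult unfolding \<psi>_def by blast
  then obtain r where r: "\<psi> v = x ^ 3 * r" ..
  have "l dvd v - \<psi> v"
    using dvd_diff_retract[of j "- (Const t4 * z)" v] scale_nonzero
    by (simp add: l_def form_def Const_mult_dvd_iff \<psi>_def y_def)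
  then obtain g0 where g0: "v = x ^ 3 * r + l * g0"
    unfolding r by (metis dvd_def add_diff_cancel_left' diff_add_cancel add.commute)
  define g where "g = - (Const (inverse 7) * g0)"
  have "7 * g = - g0"
    by (simp only: g_def mult_minus_right numeral_mult_Const_inverse)
  then have v: "v = - 7 * g * l + x ^ 3 * r"
    using g0 by (simp add: algebra_simps)
  have "(u - g * h) * (7 * l) = x ^ 3 * (w - r * h)"
    using assms unfolding v by algebra
  then have "x ^ 3 dvd (u - g * h) * (7 * l)"
    by simp
  moreover have "\<not> x dvd 7 * l"
    using scale_nonzero by (intro not_x_dvdI[of _ 1 0]) (simp add: l_def poly_eval_simps)
  ultimately have "x ^ 3 dvd u - g * h"
    using prime_x prime_elem_power_dvd_mult by blast
  then obtain p where "u = g * h + x ^ 3 * p"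
    by (metis dvd_def diff_add_cancel add.commute)
  then show thesis using v by (rule that)
qed

text \<open>A double factor p divides the x-derivative \<open>4 * x^3 * c\<close> and is prime to x,
  so it divides \<open>c\<close>. None of the three lines divides p, since each occurs only once in
  \<open>f\<close>; hence p is a unit.\<close>

lemma squarefree_f: "squarefree f"
proof (rule squarefreeI)
  fix p assume "p\<^sup>2 dvd f"
  then obtain q where q: "f = p * p * q"
    by (auto simp: power2_eq_square)
  have "\<not> x dvd p"
    using not_x_dvd(3) q by auto
  have "p dvd partial_deriv i f"
    unfolding q by (simp add: partial_deriv_mult)
  then have "p dvd 4 * (x ^ 3 * c)"
    by (simp add: partial_deriv_f mult.assoc)
  then have "p dvd x ^ 3 * c"
    by (rule dvd_numeral_multD)
  then obtain r where r: "x ^ 3 * c = r * p"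
    by (metis dvdE mult.commute)
  then have "x ^ 3 dvd r"
    using prime_x \<open>\<not> x dvd p\<close> by (metis dvd_triv_left prime_elem_power_dvd_mult)
  then obtain r' where "r = x ^ 3 * r'" ..
  with r have c: "c = r' * p"
    using x_nonzero by simp
  have not_dvd: "\<not> form a t dvd p"
    if "f = form a t * g" "\<not> form a t dvd g" "a \<noteq> 0" for a t g
  proof
    assume "form a t dvd p"
    then obtain p' where "p = form a t * p'" ..
    with q that have "form a t * g = form a t * (form a t * (p' * p' * q))"
      by (simp add: algebra_simps)
    then have "g = form a t * (p' * p' * q)"
      using prime_form[OF that(3)] by (auto simp: prime_elem_def)
    with that(2) show False by simp
  qed
  \<comment> \<open>At the point (1, -t, 1) of the line \<open>c\<close> vanishes, so the quartic
    factor equals 1, while the two other lines do not vanish.\<close>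
  have "\<not> form a1 t1 dvd (x ^ 4 + c * l) * form a2 t2 * form a3 t3"
    "\<not> form a2 t2 dvd (x ^ 4 + c * l) * form a1 t1 * form a3 t3"
    "\<not> form a3 t3 dvd (x ^ 4 + c * l) * form a1 t1 * form a2 t2"
    using scale_nonzero slopes
    by (auto intro!: not_form_dvdI[of _ 1] simp: c_def poly_eval_simps)
  moreover have "f = form a1 t1 * ((x ^ 4 + c * l) * form a2 t2 * form a3 t3)"
    "f = form a2 t2 * ((x ^ 4 + c * l) * form a1 t1 * form a3 t3)"
    "f = form a3 t3 * ((x ^ 4 + c * l) * form a1 t1 * form a2 t2)"
    by (simp_all add: f_def c_def algebra_simps)
  ultimately have "\<not> form a1 t1 dvd p" "\<not> form a2 t2 dvd p" "\<not> form a3 t3 dvd p"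
    using scale_nonzero not_dvd by blast+
  then have "c dvd r'"
    using c_dvd_cancel[of r' p] c by simp
  then obtain s where "r' = c * s" ..
  with c have "c * 1 = c * (p * s)"
    by (simp add: algebra_simps)
  then have "1 = p * s"
    using c_nonzero by (metis mult_left_cancel)
  then show "p dvd 1" ..
qed

end

section \<open>Syzygies\<close>

lemma mult_left_cancel_numeral: "numeral n * f = numeral n * g \<longleftrightarrow> f = (g :: S)"
  by (metis numeral_mult_Const_inverse mult.left_commute)

text \<open>All modules of the resolution have rank 1 or 3; elements of a rank 1 module are written
  \<open>triple p 0 0\<close>.\<close>

definition triple :: "S \<Rightarrow> S \<Rightarrow> S \<Rightarrow> nat \<Rightarrow> S" where
  "triple p q r n = (if n = 0 then p else if n = 1 then q else if n = 2 then r else 0)"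

lemma triple_simps [simp]: "triple p q r 0 = p" "triple p q r (Suc 0) = q" "triple p q r 2 = r"
  by (simp_all add: triple_def)

lemma triple_eq_iff [simp]: "triple p q r = triple p' q' r' \<longleftrightarrow> p = p' \<and> q = q' \<and> r = r'"
  by (metis triple_simps)

lemma triple_0: "(\<lambda>_. 0) = triple 0 0 0"
  by (auto simp: triple_def)

lemma free_module_3: "v \<in> free_module [b0, b1, b2] \<longleftrightarrow> (\<exists>p q r. v = triple p q r)"
proof
  assume "v \<in> free_module [b0, b1, b2]"
  then have *: "v n = 0" if "n \<ge> 3" for n using that by (simp add: free_module_def)
  have "v = triple (v 0) (v 1) (v 2)"
  proof
    fix n show "v n = triple (v 0) (v 1) (v 2) n"
      using *[of n] by (cases "n \<ge> 3") (auto simp: triple_def numeral_eq_Suc le_Suc_eq not_le less_Suc_eq)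
  qed
  then show "\<exists>p q r. v = triple p q r" by blast
qed (auto simp: free_module_def triple_def)

lemma free_module_1: "v \<in> free_module [b0] \<longleftrightarrow> (\<exists>p. v = triple p 0 0)"
proof
  assume "v \<in> free_module [b0]"
  then have "v = triple (v 0) 0 0" by (auto simp: free_module_def triple_def)
  then show "\<exists>p. v = triple p 0 0" by blast
qed (auto simp: free_module_def triple_def)

lemma homogeneous_part_3: "triple p q r \<in> homogeneous_part [b0, b1, b2] k \<longleftrightarrow>
    homogeneous (k + b0) p \<and> homogeneous (k + b1) q \<and> homogeneous (k + b2) r"
  by (auto simp: homogeneous_part_def free_module_def triple_def nth_Cons less_Suc_eq
      numeral_eq_Suc all_conj_distrib split: nat.split)

lemma homogeneous_part_1: "triple p 0 0 \<in> homogeneous_part [b0] k \<longleftrightarrow> homogeneous (k + b0) p"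
  by (auto simp: homogeneous_part_def free_module_def triple_def)

lemma homogeneous_part_subset: "homogeneous_part b k \<subseteq> free_module b"
  by (auto simp: homogeneous_part_def)

lemma triple_add: "(\<lambda>n. triple p q r n + triple p' q' r' n) = triple (p + p') (q + q') (r + r')"
  by (auto simp: triple_def)

lemma triple_smult: "(\<lambda>n. s * triple p q r n) = triple (s * p) (s * q) (s * r)"
  by (auto simp: triple_def)

context concurrent_lines
begin

text \<open>
  A syzygy is a derivation killing \<open>f\<close>. It preserves \<open>c\<close>, so its \<open>y, z\<close>-part is
  \<open>u (y \<partial>\<^sub>y + z \<partial>\<^sub>z) + v (c\<^sub>z \<partial>\<^sub>y - c\<^sub>y \<partial>\<^sub>z)\<close>; the syzygy condition then becomes
  \<open>4 a x\<^sup>3 + 3 u x\<^sup>4 + 7 u c l + v c h = 0\<close>.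
\<close>

lemma syzygy_c:
  assumes "p * cy + q * cz = 0"
  obtains v where "p = v * cz" "q = - v * cy"
proof -
  \<comment> \<open>This is z times the assumption with \<open>z * cz\<close> traded for
    \<open>3 * c - y * cy\<close>. Modulo \<open>c\<close> only a multiple of \<open>cy\<close>
    remains, and \<open>cy\<close> can be cancelled.\<close>
  have "(z * p - y * q) * cy + 3 * c * q = z * (p * cy + q * cz) - q * (y * cy + z * cz - 3 * c)"
    by algebra
  then have eq: "(z * p - y * q) * cy + 3 * c * q = 0"
    by (simp add: assms euler_c)
  have "(z * p - y * q) * cy = ((z * p - y * q) * cy + 3 * c * q) + c * (- 3 * q)"
    by algebra
  then have "(z * p - y * q) * cy = c * (- 3 * q)"
    unfolding eq by simp
  then have "c dvd z * p - y * q"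
    by (metis c_dvd_mult_cy dvd_triv_left)
  then obtain v0 where v0: "z * p - y * q = c * v0" ..
  define v where "v = Const (inverse 3) * v0"
  have v: "z * p - y * q = 3 * c * v"
    using numeral_mult_Const_inverse[of _ v0] by (simp add: v0 v_def mult.left_commute mult.assoc)
  have "3 * c * (v * cy + q) = 3 * c * v * cy + 3 * c * q"
    by algebra
  then have "3 * c * (v * cy + q) = 0"
    using eq unfolding v by simp
  then have q: "q = - v * cy"
    using c_nonzero by (simp add: add_eq_0_iff)
  have "cy * (p - v * cz) = p * cy + q * cz"
    unfolding q by algebra
  then have "cy * (p - v * cz) = 0"
    unfolding assms .
  then have "p = v * cz"
    using cy_nonzero by simp
  then show thesis using q by (rule that)
qed

lemma syzygy_f:
  assumes "a * partial_deriv i f + p * partial_deriv j f + q * partial_deriv k f = 0"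
  obtains u v where "p = u * y + v * cz" "q = u * z - v * cy"
    "4 * a * x ^ 3 + 3 * u * x ^ 4 + 7 * u * c * l + v * c * h = 0"
proof -
  have "4 * a * x ^ 3 * c + (p * cy + q * cz) * (x ^ 4 + 2 * c * l) + c ^ 2 * (p * ly + q * lz)
      = a * partial_deriv i f + p * partial_deriv j f + q * partial_deriv k f"
    unfolding partial_deriv_f by algebra
  then have eq: "4 * a * x ^ 3 * c + (p * cy + q * cz) * (x ^ 4 + 2 * c * l)
      + c ^ 2 * (p * ly + q * lz) = 0"
    unfolding assms .
  \<comment> \<open>All other terms contain \<open>c\<close>, and no line of \<open>c\<close>
    divides x. So the derivation maps \<open>c\<close> to a multiple of \<open>c\<close>.\<close>
  have "(p * cy + q * cz) * x ^ 4
      = (4 * a * x ^ 3 * c + (p * cy + q * cz) * (x ^ 4 + 2 * c * l) + c ^ 2 * (p * ly + q * lz))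
        + c * (- 4 * a * x ^ 3 - 2 * l * (p * cy + q * cz) - c * (p * ly + q * lz))"
    by algebra
  then have "(p * cy + q * cz) * x ^ 4
      = c * (- 4 * a * x ^ 3 - 2 * l * (p * cy + q * cz) - c * (p * ly + q * lz))"
    unfolding eq add_0 .
  then have "c dvd p * cy + q * cz"
    by (metis c_dvd_mult_x dvd_triv_left)
  then obtain u0 where u0: "p * cy + q * cz = c * u0" ..
  define u where "u = Const (inverse 3) * u0"
  have u: "p * cy + q * cz = 3 * c * u"
    using numeral_mult_Const_inverse[of _ u0] by (simp add: u0 u_def mult.left_commute mult.assoc)
  have "(p - u * y) * cy + (q - u * z) * cz = (p * cy + q * cz) - u * (y * cy + z * cz)"
    by algebra
  then have "(p - u * y) * cy + (q - u * z) * cz = 0"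
    unfolding u euler_c by simp
  then obtain v where v: "p - u * y = v * cz" "q - u * z = - v * cy"
    by (rule syzygy_c)
  have p: "p = u * y + v * cz" and q: "q = u * z - v * cy"
    using v by (simp_all add: algebra_simps)
  have "p * ly + q * lz = u * (y * ly + z * lz) + v * h"
    unfolding p q h_def by algebra
  then have w: "p * ly + q * lz = u * l + v * h"
    unfolding euler_l .
  have "c * (4 * a * x ^ 3 + 3 * u * x ^ 4 + 7 * u * c * l + v * c * h)
      = 4 * a * x ^ 3 * c + 3 * c * u * (x ^ 4 + 2 * c * l) + c ^ 2 * (u * l + v * h)"
    by algebra
  then have "c * (4 * a * x ^ 3 + 3 * u * x ^ 4 + 7 * u * c * l + v * c * h) = 0"
    using eq unfolding u w by simp
  then have "4 * a * x ^ 3 + 3 * u * x ^ 4 + 7 * u * c * l + v * c * h = 0"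
    using c_nonzero by simp
  with p q show thesis by (rule that)
qed

definition \<phi>1 :: "(nat \<Rightarrow> S) \<Rightarrow> nat \<Rightarrow> S" where
  "\<phi>1 v = triple (v 0 * partial_deriv i f + v 1 * partial_deriv j f + v 2 * partial_deriv k f) 0 0"

text \<open>The columns come from the solutions (u, v) = (4 h, -28 l), (4 x^3, 0), (0, 4 x^3) of the
  syzygy condition. The factor 4 clears the coefficient of \<open>a\<close> in that
  condition.\<close>

definition \<phi>2 :: "(nat \<Rightarrow> S) \<Rightarrow> nat \<Rightarrow> S" where
  "\<phi>2 v = triple
    (v 0 * (- 3 * h * x) + v 1 * (- 3 * x ^ 4 - 7 * c * l) + v 2 * (- c * h))
    (v 0 * (4 * (h * y - 7 * l * cz)) + v 1 * (4 * x ^ 3 * y) + v 2 * (4 * x ^ 3 * cz))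
    (v 0 * (4 * (h * z + 7 * l * cy)) + v 1 * (4 * x ^ 3 * z) + v 2 * (- 4 * x ^ 3 * cy))"

definition \<phi>3 :: "(nat \<Rightarrow> S) \<Rightarrow> nat \<Rightarrow> S" where
  "\<phi>3 v = triple (v 0 * x ^ 3) (v 0 * - h) (v 0 * (7 * l))"

lemma \<phi>_simps:
  "\<phi>1 (triple p q r) = triple (p * partial_deriv i f + q * partial_deriv j f + r * partial_deriv k f) 0 0"
  "\<phi>2 (triple p q r) = triple
    (p * (- 3 * h * x) + q * (- 3 * x ^ 4 - 7 * c * l) + r * (- c * h))
    (p * (4 * (h * y - 7 * l * cz)) + q * (4 * x ^ 3 * y) + r * (4 * x ^ 3 * cz))
    (p * (4 * (h * z + 7 * l * cy)) + q * (4 * x ^ 3 * z) + r * (- 4 * x ^ 3 * cy))"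
  "\<phi>3 (triple p q r) = triple (p * x ^ 3) (p * - h) (p * (7 * l))"
  by (simp_all add: \<phi>1_def \<phi>2_def \<phi>3_def)

text \<open>Every column combines two derivations, so only their values on \<open>f\<close> are
  needed: \<open>E\<close> for y d/dy + z d/dz, and \<open>H\<close> for the Hamiltonian derivation
  of \<open>c\<close>.\<close>

lemma \<phi>1_\<phi>2: "\<phi>1 (\<phi>2 (triple p q r)) = triple 0 0 0"
proof -
  define fy where "fy = partial_deriv j f"
  define fz where "fz = partial_deriv k f"
  have "y * fy + z * fz = (y * cy + z * cz) * (x ^ 4 + 2 * c * l) + c ^ 2 * (y * ly + z * lz)"
    unfolding fy_def fz_def partial_deriv_f by algebra
  then have E: "y * fy + z * fz = 3 * c * x ^ 4 + 7 * c ^ 2 * l"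
    unfolding euler_c euler_l by algebra
  have H: "cz * fy - cy * fz = c ^ 2 * h"
    unfolding fy_def fz_def partial_deriv_f h_def by algebra
  have "(p * (- 3 * h * x) + q * (- 3 * x ^ 4 - 7 * c * l) + r * (- c * h)) * (4 * x ^ 3 * c)
   + (p * (4 * (h * y - 7 * l * cz)) + q * (4 * x ^ 3 * y) + r * (4 * x ^ 3 * cz)) * fy
   + (p * (4 * (h * z + 7 * l * cy)) + q * (4 * x ^ 3 * z) + r * (- 4 * x ^ 3 * cy)) * fz
   = 4 * (p * h + q * x ^ 3) * (y * fy + z * fz) + 4 * (r * x ^ 3 - 7 * p * l) * (cz * fy - cy * fz)
     - 4 * x ^ 3 * c * (3 * p * h * x + q * (3 * x ^ 4 + 7 * c * l) + r * c * h)"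
    by algebra
  also have "\<dots> = 0"
    unfolding E H by algebra
  finally show ?thesis
    by (simp add: \<phi>_simps partial_deriv_f(1) fy_def fz_def)
qed

lemma \<phi>2_\<phi>3: "\<phi>2 (\<phi>3 (triple p q r)) = triple 0 0 0"
  by (simp add: \<phi>_simps algebra_simps power_numeral_reduce)

lemma \<phi>1_kernel:
  assumes "\<phi>1 (triple a p q) = triple 0 0 0"
  shows "\<exists>g1 g2 g3. triple a p q = \<phi>2 (triple g1 g2 g3)"
proof -
  obtain u v where p: "p = u * y + v * cz" and q: "q = u * z - v * cy"
    and uv: "4 * a * x ^ 3 + 3 * u * x ^ 4 + 7 * u * c * l + v * c * h = 0"
    using assms syzygy_f[of a p q] by (auto simp: \<phi>_simps)
  have "(7 * u * l + v * h) * c = (4 * a * x ^ 3 + 3 * u * x ^ 4 + 7 * u * c * l + v * c * h)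
      + x ^ 3 * (- 4 * a - 3 * u * x)"
    by algebra
  then have "(7 * u * l + v * h) * c = x ^ 3 * (- 4 * a - 3 * u * x)"
    unfolding uv by simp
  then have "x ^ 3 dvd (7 * u * l + v * h) * c"
    by simp
  then have "x ^ 3 dvd 7 * u * l + v * h"
    using prime_x not_x_dvd(1) prime_elem_power_dvd_mult by blast
  then obtain w where "7 * u * l + v * h = x ^ 3 * w" ..
  then obtain g' r' s' where "u = g' * h + x ^ 3 * r'" "v = - 7 * g' * l + x ^ 3 * s'"
    by (rule syzygy_l_h_mod_x3)
  \<comment> \<open>Numerals are units of S, so the multipliers may be written with the factor 4
    built into the columns of \<phi>2.\<close>
  moreover obtain g r s where "g' = 4 * g" "r' = 4 * r" "s' = 4 * s"
    by (metis numeral_mult_Const_inverse)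
  ultimately have u: "u = 4 * g * h + x ^ 3 * (4 * r)" and v: "v = - 7 * (4 * g) * l + x ^ 3 * (4 * s)"
    by simp_all
  have "x ^ 3 * (4 * a + 3 * u * x + 4 * c * (7 * r * l + s * h))
      = 4 * a * x ^ 3 + 3 * u * x ^ 4 + 7 * u * c * l + v * c * h"
    unfolding u v by algebra
  then have "x ^ 3 * (4 * a + 3 * u * x + 4 * c * (7 * r * l + s * h)) = 0"
    unfolding uv .
  then have a: "4 * a + 3 * u * x + 4 * c * (7 * r * l + s * h) = 0"
    by (metis mult_eq_0_iff power_not_zero x_nonzero)
  have "4 * a - 4 * (g * (- 3 * h * x) + r * (- 3 * x ^ 4 - 7 * c * l) + s * (- c * h))
      = 4 * a + 3 * u * x + 4 * c * (7 * r * l + s * h)"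
    unfolding u by algebra
  then have "4 * a = 4 * (g * (- 3 * h * x) + r * (- 3 * x ^ 4 - 7 * c * l) + s * (- c * h))"
    unfolding a by simp
  moreover have "p = g * (4 * (h * y - 7 * l * cz)) + r * (4 * x ^ 3 * y) + s * (4 * x ^ 3 * cz)"
    unfolding p u v by algebra
  moreover have "q = g * (4 * (h * z + 7 * l * cy)) + r * (4 * x ^ 3 * z) + s * (- 4 * x ^ 3 * cy)"
    unfolding q u v by algebra
  ultimately show ?thesis
    unfolding mult_left_cancel_numeral \<phi>_simps by blast
qed

text \<open>Up to the factor 4, \<open>U\<close> and \<open>V\<close> are the coordinates (u, v) of
  the combined syzygy. They vanish because the matrix with rows (y, cz) and (z, -cy) has determinant
  -3 c. Then \<open>x^3\<close> must divide g1, and g1 determines g2 and g3.\<close>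

lemma \<phi>2_kernel:
  assumes "\<phi>2 (triple g1 g2 g3) = triple 0 0 0"
  shows "\<exists>s. triple g1 g2 g3 = \<phi>3 (triple s 0 0)"
proof -
  define U where "U = g1 * h + g2 * x ^ 3"
  define V where "V = g3 * x ^ 3 - 7 * g1 * l"
  have "4 * (y * U + cz * V) = 4 * 0" "4 * (z * U - cy * V) = 4 * 0"
    using assms by (simp_all add: \<phi>_simps U_def V_def algebra_simps)
  then have UV: "y * U + cz * V = 0" "z * U - cy * V = 0"
    unfolding mult_left_cancel_numeral by auto
  have "(y * cy + z * cz) * U = cy * (y * U + cz * V) + cz * (z * U - cy * V)"
    by algebra
  then have "3 * c * U = 0"
    unfolding UV euler_c by simp
  then have U: "U = 0"
    using c_nonzero by simp
  then have V: "V = 0"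
    using UV cy_nonzero by simp
  have "g1 * h = U + x ^ 3 * - g2"
    unfolding U_def by algebra
  then have "g1 * h = x ^ 3 * - g2"
    unfolding U by simp
  then have "x ^ 3 dvd g1 * h"
    by simp
  then have "x ^ 3 dvd g1"
    using prime_x not_x_dvd_h prime_elem_power_dvd_mult by blast
  then obtain s where s: "g1 = x ^ 3 * s" ..
  have "x ^ 3 * (g2 + s * h) = U" "x ^ 3 * (g3 - 7 * s * l) = V"
    unfolding U_def V_def s by algebra+
  then have "x ^ 3 * (g2 + s * h) = 0" "x ^ 3 * (g3 - 7 * s * l) = 0"
    unfolding U V by simp_all
  then have "g2 = s * - h" "g3 = s * (7 * l)"
    using x_nonzero by (simp_all add: add_eq_0_iff)
  with s show ?thesis
    by (intro exI[of _ s]) (simp add: \<phi>_simps mult.commute)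
qed

end

section \<open>The minimal resolution\<close>

lemma homogeneous_mult_eq: "homogeneous k f \<Longrightarrow> homogeneous l g \<Longrightarrow> n = k + l \<Longrightarrow> homogeneous n (f * g)"
  using homogeneous_mult by blast

section \<open>Residue classes modulo the Jacobian ideal\<close>

lemma jacobian_ideal_0: "0 \<in> jacobian_ideal f"
proof -
  have "0 = (\<Sum>i\<in>UNIV. 0 * partial_deriv i f)" by simp
  then show ?thesis unfolding jacobian_ideal_def by fast
qed

lemma jacobian_ideal_add:
  assumes "g \<in> jacobian_ideal f" "g' \<in> jacobian_ideal f"
  shows "g + g' \<in> jacobian_ideal f"
proof -
  from assms obtain a a' where "g = (\<Sum>i\<in>UNIV. a i * partial_deriv i f)"
    "g' = (\<Sum>i\<in>UNIV. a' i * partial_deriv i f)"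
    unfolding jacobian_ideal_def by blast
  then have "g + g' = (\<Sum>i\<in>UNIV. (a i + a' i) * partial_deriv i f)"
    by (simp add: distrib_right sum.distrib)
  then show ?thesis unfolding jacobian_ideal_def by fast
qed

lemma jacobian_ideal_uminus:
  assumes "g \<in> jacobian_ideal f"
  shows "- g \<in> jacobian_ideal f"
proof -
  from assms obtain a where "g = (\<Sum>i\<in>UNIV. a i * partial_deriv i f)"
    unfolding jacobian_ideal_def by blast
  then have "- g = (\<Sum>i\<in>UNIV. - a i * partial_deriv i f)"
    by (simp add: sum_negf)
  then show ?thesis unfolding jacobian_ideal_def by fast
qed

lemma triple_in_free_module [simp]: "triple p q r \<in> free_module [b0, b1, b2]" "triple p 0 0 \<in> free_module [b0]"
  by (auto simp: free_module_3 free_module_1)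

lemma equiv_jacobian_rel: "equiv UNIV (jacobian_rel f)"
proof (rule equivI)
  show "refl (jacobian_rel f)"
    by (simp add: refl_on_def jacobian_rel_def jacobian_ideal_0)
  show "sym (jacobian_rel f)"
    by (rule symI) (use jacobian_ideal_uminus in \<open>force simp: jacobian_rel_def\<close>)
  show "trans (jacobian_rel f)"
    by (rule transI) (use jacobian_ideal_add in \<open>force simp: jacobian_rel_def\<close>)
qed simp

lemma milnor_proj_eq_0_iff: "milnor_proj f g = milnor_proj f 0 \<longleftrightarrow> g \<in> jacobian_ideal f"
  unfolding milnor_proj_def
  by (subst eq_equiv_class_iff[OF equiv_jacobian_rel]) (simp_all add: jacobian_rel_def)

text \<open>The coordinates i, j, k are an arbitrary permutation of the indices, so sums over the
  index type are expanded along it.\<close>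

lemma sum_UNIV_distinct_3:
  fixes F :: "3 \<Rightarrow> 'a::comm_monoid_add"
  assumes "i \<noteq> j" "i \<noteq> k" "j \<noteq> k"
  shows "(\<Sum>n\<in>UNIV. F n) = F i + F j + F k"
proof -
  have "card {i, j, k} = CARD(3)"
    using assms by simp
  then have UNIV_eq: "UNIV = {i, j, k}"
    by (metis card_subset_eq finite subset_UNIV)
  show ?thesis unfolding UNIV_eq using assms by (simp add: add.assoc)
qed

section \<open>Grading, exactness and minimality of the complex\<close>

context concurrent_lines
begin

lemma homogeneous_vars: "homogeneous 1 x" "homogeneous 1 y" "homogeneous 1 z"
  by (simp_all add: x_def y_def z_def homogeneous_var)

lemma homogeneous_form: "homogeneous 1 (form a t)"
  unfolding form_def
  by (rule homogeneous_mult_eq[OF homogeneous_Const homogeneous_add[OF homogeneous_vars(2)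
        homogeneous_mult_eq[OF homogeneous_Const homogeneous_vars(3)]]]) simp_all

lemma homogeneous_c: "homogeneous 3 c" and homogeneous_l: "homogeneous 1 l"
  unfolding c_def l_def
  by (rule homogeneous_form homogeneous_mult_eq | simp)+

lemma homogeneous_cy: "homogeneous 2 cy" and homogeneous_cz: "homogeneous 2 cz"
  using homogeneous_partial_deriv[OF homogeneous_c] by (simp_all add: cy_def cz_def)

lemma homogeneous_h: "homogeneous 2 h"
  unfolding h_def ly_def lz_def
  by (intro homogeneous_diff homogeneous_mult_eq[OF homogeneous_cz homogeneous_Const]
      homogeneous_mult_eq[OF homogeneous_cy homogeneous_Const]) simp_all

lemma homogeneous_x_power: "homogeneous (int n) (x ^ n)"
  using homogeneous_power[OF homogeneous_vars(1)] by simp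

lemma homogeneous_f: "homogeneous 7 f"
proof -
  have "homogeneous 4 (x ^ 4 + c * l)"
    using homogeneous_x_power[of 4] homogeneous_mult[OF homogeneous_c homogeneous_l]
    by (simp add: homogeneous_add)
  from homogeneous_mult[OF this homogeneous_c] show ?thesis by (simp add: f_def)
qed

text \<open>The entries of \<phi>2 row by row, then those of \<phi>3; later proofs select them by
  position.\<close>

lemma homogeneous_generators:
  "homogeneous 3 (- 3 * h * x)" "homogeneous 4 (- 3 * x ^ 4 - 7 * c * l)" "homogeneous 5 (- c * h)"
  "homogeneous 3 (4 * (h * y - 7 * l * cz))" "homogeneous 4 (4 * x ^ 3 * y)" "homogeneous 5 (4 * x ^ 3 * cz)"
  "homogeneous 3 (4 * (h * z + 7 * l * cy))" "homogeneous 4 (4 * x ^ 3 * z)" "homogeneous 5 (- 4 * x ^ 3 * cy)"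
  "homogeneous 3 (x ^ 3)" "homogeneous 2 (- h)" "homogeneous 1 (7 * l)"
  by (rule homogeneous_vars homogeneous_c homogeneous_l homogeneous_cy homogeneous_cz homogeneous_h
      homogeneous_numeral homogeneous_x_power[of 3, simplified] homogeneous_x_power[of 4, simplified]
      homogeneous_uminus homogeneous_diff homogeneous_add homogeneous_mult_eq
    | simp only: arith_simps)+

lemma homogeneous_partial_deriv_f: "homogeneous 6 (partial_deriv n f)"
  using homogeneous_partial_deriv[OF homogeneous_f] by simp

text \<open>The constant term is the value at the origin and hence multiplicative. This turns
  positive degree of the matrix entries into minimality.\<close>

lemma lookup_mult_homogeneous_0:
  assumes "homogeneous d g" "d \<noteq> 0"
  shows "Poly_Mapping.lookup (p * g) 0 = 0"
proof -
  have "Poly_Mapping.lookup g 0 = 0"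
    using assms by (force simp: homogeneous_def mdegree_def in_keys_iff)
  then show ?thesis by (simp add: poly_eval_simps flip: poly_eval_0)
qed

text \<open>The shifts -9, -10, -11 are 1 - 7 - k for k = 3, 4, 5, and the relation sits in degree
  12 = 9 + 3 = 10 + 2 = 11 + 1.\<close>

lemma graded_hom_\<phi>3: "graded_hom [-12] [-9, -10, -11] \<phi>3"
  unfolding graded_hom_def
proof (intro conjI allI ballI)
  fix d :: int and v assume v: "v \<in> homogeneous_part [-12] d"
  then obtain p where p: "v = triple p 0 0" "homogeneous (d + - 12) p"
    using homogeneous_part_subset[of "[-12]" d] by (auto simp: free_module_1 homogeneous_part_1 subset_iff)
  then show "\<phi>3 v \<in> homogeneous_part [-9, -10, -11] d"
    unfolding p(1) \<phi>_simps homogeneous_part_3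
    by (intro conjI homogeneous_mult_eq[OF p(2) homogeneous_generators(10)]
        homogeneous_mult_eq[OF p(2) homogeneous_generators(11)]
        homogeneous_mult_eq[OF p(2) homogeneous_generators(12)]) simp_all
qed (auto dest!: free_module_1[THEN iffD1] simp: \<phi>_simps triple_add triple_smult algebra_simps)

lemma graded_hom_\<phi>2: "graded_hom [-9, -10, -11] [-6, -6, -6] \<phi>2"
  unfolding graded_hom_def
proof (intro conjI allI ballI)
  fix d :: int and v assume v: "v \<in> homogeneous_part [-9, -10, -11] d"
  then obtain p q r where p: "v = triple p q r"
    "homogeneous (d + - 9) p" "homogeneous (d + - 10) q" "homogeneous (d + - 11) r"
    using homogeneous_part_subset[of "[-9, -10, -11]" d]
    by (auto simp: free_module_3 homogeneous_part_3 subset_iff)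
  then show "\<phi>2 v \<in> homogeneous_part [-6, -6, -6] d"
    unfolding p(1) \<phi>_simps homogeneous_part_3
    by (intro conjI homogeneous_add homogeneous_mult_eq[OF p(2) homogeneous_generators(1)]
        homogeneous_mult_eq[OF p(2) homogeneous_generators(4)]
        homogeneous_mult_eq[OF p(2) homogeneous_generators(7)]
        homogeneous_mult_eq[OF p(3) homogeneous_generators(2)]
        homogeneous_mult_eq[OF p(3) homogeneous_generators(5)]
        homogeneous_mult_eq[OF p(3) homogeneous_generators(8)]
        homogeneous_mult_eq[OF p(4) homogeneous_generators(3)]
        homogeneous_mult_eq[OF p(4) homogeneous_generators(6)]
        homogeneous_mult_eq[OF p(4) homogeneous_generators(9)]) simp_all
qed (auto dest!: free_module_3[THEN iffD1] simp: \<phi>_simps triple_add triple_smult algebra_simps)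

lemma graded_hom_\<phi>1: "graded_hom [-6, -6, -6] [0] \<phi>1"
  unfolding graded_hom_def
proof (intro conjI allI ballI)
  fix d :: int and v assume v: "v \<in> homogeneous_part [-6, -6, -6] d"
  then obtain p q r where p: "v = triple p q r"
    "homogeneous (d + - 6) p" "homogeneous (d + - 6) q" "homogeneous (d + - 6) r"
    using homogeneous_part_subset[of "[-6, -6, -6]" d]
    by (auto simp: free_module_3 homogeneous_part_3 subset_iff)
  then show "\<phi>1 v \<in> homogeneous_part [0] d"
    unfolding p(1) \<phi>_simps homogeneous_part_1
    by (intro homogeneous_add homogeneous_mult_eq[OF _ homogeneous_partial_deriv_f]) auto
qed (auto dest!: free_module_3[THEN iffD1] simp: \<phi>_simps triple_add triple_smult algebra_simps)

lemma \<phi>1_image: "\<phi>1 ` free_module [-6, -6, -6]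
    = {v \<in> free_module [0]. milnor_proj f (v 0) = milnor_proj f 0}"
proof (intro equalityI subsetI)
  fix w assume "w \<in> \<phi>1 ` free_module [-6, -6, -6]"
  then obtain p q r where w: "w = \<phi>1 (triple p q r)"
    by (auto simp: free_module_3)
  have "p * partial_deriv i f + q * partial_deriv j f + r * partial_deriv k f
      = (\<Sum>n\<in>UNIV. (if n = i then p else if n = j then q else r) * partial_deriv n f)"
    using ijk by (simp add: sum_UNIV_distinct_3[OF ijk])
  then have "w 0 \<in> jacobian_ideal f"
    unfolding w \<phi>_simps triple_simps jacobian_ideal_def by fast
  then show "w \<in> {v \<in> free_module [0]. milnor_proj f (v 0) = milnor_proj f 0}"
    by (auto simp: milnor_proj_eq_0_iff w \<phi>_simps free_module_1)
next
  fix w assume "w \<in> {v \<in> free_module [0]. milnor_proj f (v 0) = milnor_proj f 0}"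
  then obtain s where w: "w = triple s 0 0" "s \<in> jacobian_ideal f"
    by (auto simp: milnor_proj_eq_0_iff free_module_1)
  then obtain a where "s = a i * partial_deriv i f + a j * partial_deriv j f + a k * partial_deriv k f"
    by (auto simp: jacobian_ideal_def sum_UNIV_distinct_3[OF ijk])
  then have "w = \<phi>1 (triple (a i) (a j) (a k))"
    by (simp add: w \<phi>_simps)
  moreover have "triple (a i) (a j) (a k) \<in> free_module [-6, -6, -6]"
    by (auto simp: free_module_3)
  ultimately show "w \<in> \<phi>1 ` free_module [-6, -6, -6]"
    by blast
qed

lemma \<phi>2_image: "\<phi>2 ` free_module [-9, -10, -11] = {v \<in> free_module [-6, -6, -6]. \<phi>1 v = (\<lambda>_. 0)}"
proof (intro equalityI subsetI)
  fix w assume "w \<in> \<phi>2 ` free_module [-9, -10, -11]"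
  then obtain p q r where w: "w = \<phi>2 (triple p q r)"
    by (auto simp: free_module_3)
  then show "w \<in> {v \<in> free_module [-6, -6, -6]. \<phi>1 v = (\<lambda>_. 0)}"
    using \<phi>1_\<phi>2[of p q r] by (auto simp: triple_0 \<phi>2_def free_module_3)
next
  fix w assume "w \<in> {v \<in> free_module [-6, -6, -6]. \<phi>1 v = (\<lambda>_. 0)}"
  then show "w \<in> \<phi>2 ` free_module [-9, -10, -11]"
    using \<phi>1_kernel by (force simp: free_module_3 triple_0)
qed

lemma \<phi>3_image: "\<phi>3 ` free_module [-12] = {v \<in> free_module [-9, -10, -11]. \<phi>2 v = (\<lambda>_. 0)}"
proof (intro equalityI subsetI)
  fix w assume "w \<in> \<phi>3 ` free_module [-12]"
  then obtain p where w: "w = \<phi>3 (triple p 0 0)"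
    by (auto simp: free_module_1)
  then show "w \<in> {v \<in> free_module [-9, -10, -11]. \<phi>2 v = (\<lambda>_. 0)}"
    using \<phi>2_\<phi>3[of p 0 0] by (auto simp: triple_0 \<phi>3_def free_module_3)
next
  fix w assume "w \<in> {v \<in> free_module [-9, -10, -11]. \<phi>2 v = (\<lambda>_. 0)}"
  then show "w \<in> \<phi>3 ` free_module [-12]"
    using \<phi>2_kernel by (force simp: free_module_1 free_module_3 triple_0)
qed

lemma minimal_\<phi>: "minimal_hom [-12] \<phi>3" "minimal_hom [-9, -10, -11] \<phi>2" "minimal_hom [-6, -6, -6] \<phi>1"
proof -
  note l0 = homogeneous_generators[THEN lookup_mult_homogeneous_0]
    homogeneous_partial_deriv_f[THEN lookup_mult_homogeneous_0]
  show "minimal_hom [-12] \<phi>3" "minimal_hom [-9, -10, -11] \<phi>2" "minimal_hom [-6, -6, -6] \<phi>1"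
    unfolding minimal_hom_def
    by (intro ballI allI, simp only: \<phi>3_def \<phi>2_def \<phi>1_def triple_def lookup_add l0 simp_thms
        zero_neq_one[symmetric] zero_neq_numeral[symmetric] lookup_zero add_0 if_cancel
        split: if_splits)+
qed

lemma minimal_free_resolution:
  "minimal_free_resolution_milnor f [-12] [-9, -10, -11] [-6, -6, -6] \<phi>3 \<phi>2 \<phi>1"
  unfolding minimal_free_resolution_milnor_def
proof (intro conjI graded_hom_\<phi>1 graded_hom_\<phi>2 graded_hom_\<phi>3 \<phi>1_image \<phi>2_image \<phi>3_image minimal_\<phi>)
  show "inj_on \<phi>3 (free_module [-12])"
    using x_nonzero by (auto simp: inj_on_def free_module_1 \<phi>_simps)
  show "(\<lambda>v. milnor_proj f (v 0)) ` free_module [0] = milnor_algebra f"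
  proof (intro equalityI subsetI)
    fix X assume "X \<in> milnor_algebra f"
    then obtain g where "X = milnor_proj f g"
      by (auto simp: milnor_algebra_def quotient_def milnor_proj_def)
    moreover have "triple g 0 0 \<in> free_module [0]"
      by (auto simp: free_module_1)
    ultimately show "X \<in> (\<lambda>v. milnor_proj f (v 0)) ` free_module [0]"
      by (intro image_eqI[of _ _ "triple g 0 0"]) simp_all
  qed (auto simp: milnor_algebra_def quotient_def milnor_proj_def)
qed

theorem plus_one_generated_f: "plus_one_generated f"
proof -
  have "reduced_curve f 7"
    using homogeneous_f squarefree_f by (simp add: reduced_curve_def)
  moreover have "minimal_free_resolution_milnor f (map (\<lambda>e. - e) [12])
      (map (\<lambda>k. 1 - int 7 - int k) [3, 4, 5]) (replicate 3 (1 - int 7)) \<phi>3 \<phi>2 \<phi>1"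
    using minimal_free_resolution by (simp add: numeral_3_eq_3)
  ultimately have "syzygy_curve 3 f 7 [3, 4, 5]"
    unfolding syzygy_curve_def by (intro conjI exI[of _ "[12]"] exI) auto
  then show ?thesis
    unfolding plus_one_generated_def by (intro exI[of _ 7] exI[of _ 3] exI[of _ 4] exI[of _ 5]) simp
qed

end

section \<open>Hyperosculating lines of the Dyck quartic\<close>

lemma obtain_complement_3:
  fixes i :: 3
  obtains j k where "i \<noteq> j" "i \<noteq> k" "j \<noteq> k"
proof -
  have "(1::3) \<noteq> 2" "(1::3) \<noteq> 3" "(2::3) \<noteq> 3" by simp_all
  then show thesis using exhaust_3[of i] that by metis
qed

definition linear_form :: "(3 \<Rightarrow> complex) \<Rightarrow> S" where
  "linear_form \<alpha> = (\<Sum>n\<in>UNIV. Const (\<alpha> n) * var n)"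

lemma poly_eval_linear_form: "poly_eval (linear_form \<alpha>) v = (\<Sum>n\<in>UNIV. \<alpha> n * v n)"
  by (simp add: linear_form_def sum_3 poly_eval_simps)

lemma zero_locus_linear_form:
  "P \<in> zero_locus (linear_form \<alpha>) \<longleftrightarrow> P \<noteq> 0 \<and> (\<Sum>n\<in>UNIV. \<alpha> n * P $ n) = 0"
  by (simp add: zero_locus_def poly_eval_linear_form flip: poly_eval_def)

lemma line_eq_linear_form:
  assumes "is_line L"
  obtains \<alpha> where "L = linear_form \<alpha>" "\<exists>n. \<alpha> n \<noteq> 0"
proof -
  define \<alpha> where "\<alpha> n = Poly_Mapping.lookup L (Poly_Mapping.single n 1)" for n
  have L: "L = linear_form \<alpha>"
    using homogeneous_1_eq[of L] assms by (simp add: is_line_def linear_form_def \<alpha>_def)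
  moreover have "\<exists>n. \<alpha> n \<noteq> 0"
  proof (rule ccontr)
    assume "\<not> ?thesis"
    then have "L = 0" by (simp add: L linear_form_def)
    then show False using assms by (simp add: is_line_def)
  qed
  ultimately show thesis by (rule that)
qed

text \<open>The line passes through the coordinate point m and is a linear factor of the sum of the
  fourth powers of the other two coordinates.\<close>

definition hyperosculating_form :: "3 \<Rightarrow> (3 \<Rightarrow> complex) \<Rightarrow> bool" where
  "hyperosculating_form m \<alpha> \<longleftrightarrow> \<alpha> m = 0 \<and> (\<forall>n. n \<noteq> m \<longrightarrow> \<alpha> n \<noteq> 0) \<and> (\<Sum>n\<in>UNIV. \<alpha> n ^ 4) = 0"

lemma dyck_quartic_eq: "dyck_quartic = (\<Sum>n\<in>UNIV. var n ^ 4)"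
  by (simp add: dyck_quartic_def sum_3)

lemma order_4_coeffs:
  assumes "order 0 (p :: complex poly) = 4" "n < 4"
  shows "coeff p n = 0"
proof -
  have "[:0, 1:] ^ 4 dvd p"
    using order_1[of 0 p] assms(1) by simp
  then have "monom 1 4 dvd p"
    by (simp add: monom_altdef)
  then show ?thesis
    using assms(2) by (simp add: monom_1_dvd_iff')
qed

lemma coeff_linear_power_4:
  "coeff ([:p, q:] ^ 4) (Suc 0) = 4 * p ^ 3 * (q :: complex)" "coeff ([:p, q:] ^ 4) 2 = 6 * p ^ 2 * q ^ 2"
  by (simp_all add: numeral_eq_Suc algebra_simps)

lemma restrict_dyck_quartic:
  "restrict_to_line dyck_quartic P Q = (\<Sum>n\<in>UNIV. [:P $ n, Q $ n:] ^ 4)"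
  by (simp add: restrict_to_line_def dyck_quartic_def restrict.subst_simps sum_3)

text \<open>The tangent at P has coefficients proportional to the cubes of the coordinates of P.
  Since the fourth powers of the j and k coordinates are opposite, so are their twelfth
  powers.\<close>

lemma hyperosculating_form_of_flex:
  fixes P :: "complex ^ 3"
  assumes ijk: "i \<noteq> j" "i \<noteq> k" "j \<noteq> k" and P: "P \<noteq> 0" "P $ i = 0" "(\<Sum>n\<in>UNIV. (P $ n) ^ 4) = 0"
    and tangent: "\<And>m n. \<alpha> m * (P $ n) ^ 3 = \<alpha> n * (P $ m) ^ 3" and nz: "\<exists>n. \<alpha> n \<noteq> 0"
  shows "hyperosculating_form i \<alpha>"
proof -
  have cases: "n = i \<or> n = j \<or> n = k" for n
  proof -
    \<comment> \<open>The indicator of n has sum 1 over all indices, so it cannot vanish at i, j and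
      k simultaneously.\<close>
    have "(\<Sum>m\<in>UNIV. if m = n then 1 else 0 :: nat) = 1" by simp
    then show ?thesis
      unfolding sum_UNIV_distinct_3[OF ijk] by (auto split: if_splits)
  qed
  have P4: "(P $ j) ^ 4 + (P $ k) ^ 4 = 0"
    using P(2,3) by (simp add: sum_UNIV_distinct_3[OF ijk])
  have nzP: "P $ j \<noteq> 0" "P $ k \<noteq> 0"
  proof -
    have "P = 0" if "P $ j = 0 \<or> P $ k = 0"
    proof -
      have "P $ n = 0" for n
        using that P4 P(2) cases[of n] by auto
      then show ?thesis by (simp add: vec_eq_iff)
    qed
    then show "P $ j \<noteq> 0" "P $ k \<noteq> 0" using P(1) by auto
  qed
  have i: "\<alpha> i = 0"
    using tangent[of i j] P(2) nzP by simp
  have jk: "\<alpha> j * (P $ k) ^ 3 = \<alpha> k * (P $ j) ^ 3"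
    by (rule tangent)
  have nzjk: "\<alpha> j \<noteq> 0" "\<alpha> k \<noteq> 0"
    using nz jk i nzP cases by (metis mult_eq_0_iff power_not_zero)+
  have "((P $ j) ^ 4) ^ 3 = - (((P $ k) ^ 4) ^ 3)"
    using P4 by (simp add: add_eq_0_iff)
  moreover have "\<alpha> j ^ 4 * ((P $ k) ^ 4) ^ 3 = \<alpha> k ^ 4 * ((P $ j) ^ 4) ^ 3"
    using arg_cong[OF jk, of "\<lambda>w. w ^ 4"] by (simp add: power_mult_distrib flip: power_mult)
  ultimately have "(\<alpha> j ^ 4 + \<alpha> k ^ 4) * ((P $ k) ^ 4) ^ 3 = 0"
    by (simp add: algebra_simps)
  then have "\<alpha> j ^ 4 + \<alpha> k ^ 4 = 0"
    using nzP by simp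
  then have "(\<Sum>n\<in>UNIV. \<alpha> n ^ 4) = 0"
    using i by (simp add: sum_UNIV_distinct_3[OF ijk])
  moreover have "\<alpha> n \<noteq> 0" if "n \<noteq> i" for n
    using that cases[of n] nzjk by auto
  ultimately show ?thesis
    using i by (simp add: hyperosculating_form_def)
qed

text \<open>Order 4 kills the coefficients of t and t^2 in the restriction. The first makes the line
  the tangent at P; the second, tested on one vector of the tangent, puts P on a coordinate
  line.\<close>

lemma hyperosculating_dyck_quartic:
  assumes "hyperosculating dyck_quartic L"
  obtains m \<alpha> where "L = linear_form \<alpha>" "hyperosculating_form m \<alpha>"
proof -
  obtain \<alpha> where L: "L = linear_form \<alpha>" and nz: "\<exists>n. \<alpha> n \<noteq> 0"
    using assms line_eq_linear_form by (auto simp: hyperosculating_def)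
  obtain P where P: "P \<in> zero_locus L" "P \<in> zero_locus dyck_quartic"
    and mult: "meets_with_multiplicity dyck_quartic L P 4"
    using assms by (auto simp: hyperosculating_def)
  have P0: "P \<noteq> 0"
    using P by (simp add: zero_locus_def)
  have P4: "(\<Sum>n\<in>UNIV. (P $ n) ^ 4) = 0"
    using P(2) by (simp add: zero_locus_def dyck_quartic_eq sum_3 poly_eval_simps flip: poly_eval_def)
  \<comment> \<open>Multiples of P, zero included, are also allowed. The multiplicity condition says
    nothing about them, but the equation of the curve at P does.\<close>
  have Q: "(\<Sum>n\<in>UNIV. (P $ n) ^ 3 * Q $ n) = 0 \<and> (\<Sum>n\<in>UNIV. (P $ n) ^ 2 * (Q $ n) ^ 2) = 0"
    if "(\<Sum>n\<in>UNIV. \<alpha> n * Q $ n) = 0" for Q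
  proof (cases "\<exists>c. Q = c *s P")
    case True
    then obtain c where "Q = c *s P" ..
    then have "(P $ n) ^ 3 * Q $ n = c * (P $ n) ^ 4" "(P $ n) ^ 2 * (Q $ n) ^ 2 = c ^ 2 * (P $ n) ^ 4" for n
      by (simp_all add: power_numeral_reduce)
    then show ?thesis using P4 by (simp flip: sum_distrib_left)
  next
    case False
    then have "Q \<noteq> 0" "\<not> same_point P Q"
      by (auto simp: same_point_def)
    then have order: "order 0 (restrict_to_line dyck_quartic P Q) = 4"
      using mult that by (auto simp: meets_with_multiplicity_def L zero_locus_linear_form)
    show ?thesis
      using order_4_coeffs[OF order, of 1] order_4_coeffs[OF order, of 2]
      by (simp add: restrict_dyck_quartic coeff_sum coeff_linear_power_4 mult.assoc
          flip: sum_distrib_left)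
  qed
  have tangent: "\<alpha> m * (P $ n) ^ 3 = \<alpha> n * (P $ m) ^ 3" for m n
  proof (cases "m = n")
    case False
    \<comment> \<open>A solution of the equation of the line supported on the coordinates m and n;
      it may be zero, which \<open>Q\<close> permits.\<close>
    define R :: "complex ^ 3" where "R = (\<chi> p. if p = m then \<alpha> n else if p = n then - \<alpha> m else 0)"
    have sum_R: "(\<Sum>p\<in>UNIV. F p * R $ p) = F m * \<alpha> n - F n * \<alpha> m" for F
    proof -
      have "(\<Sum>p\<in>UNIV. F p * R $ p) = (\<Sum>p\<in>UNIV. (if p = m then F p * \<alpha> n else 0)
          + (if p = n then - (F p * \<alpha> m) else 0))"
        using False by (intro sum.cong) (auto simp: R_def)
      then show ?thesis by (simp add: sum.distrib)
    qed
    show ?thesis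
      using Q[of R] sum_R[of \<alpha>] sum_R[of "\<lambda>p. (P $ p) ^ 3"] by (simp add: mult.commute)
  qed simp
  have "P $ 1 = 0 \<or> P $ 2 = 0 \<or> P $ 3 = 0"
  proof -
    \<comment> \<open>This vector lies on the tangent. The quadratic condition on it, with the
      equation of the curve, says that the product of P1^2, P2^2 and P3^4 is zero.\<close>
    define R :: "complex ^ 3" where "R = (\<chi> p. if p = 1 then (P $ 2) ^ 3 else if p = 2 then - ((P $ 1) ^ 3) else 0)"
    have "(\<Sum>n\<in>UNIV. \<alpha> n * R $ n) = 0"
      using tangent[of 1 2] by (simp add: sum_3 R_def)
    then have "(P $ 1) ^ 2 * ((P $ 2) ^ 3) ^ 2 + (P $ 2) ^ 2 * ((P $ 1) ^ 3) ^ 2 = 0"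
      using Q[of R] by (simp add: sum_3 R_def)
    then have "(P $ 1) ^ 2 * (P $ 2) ^ 2 * ((P $ 1) ^ 4 + (P $ 2) ^ 4) = 0"
      by algebra
    then show ?thesis
      using P4 by (auto simp: sum_3)
  qed
  then consider "P $ 1 = 0" | "P $ 2 = 0" | "P $ 3 = 0" by blast
  then obtain m where "hyperosculating_form m \<alpha>"
  proof cases
    case 1
    then show ?thesis
      using that hyperosculating_form_of_flex[OF _ _ _ P0 _ P4 tangent nz, of 1 2 3] by simp
  next
    case 2
    then show ?thesis
      using that hyperosculating_form_of_flex[OF _ _ _ P0 _ P4 tangent nz, of 2 1 3] by simp
  next
    case 3
    then show ?thesis
      using that hyperosculating_form_of_flex[OF _ _ _ P0 _ P4 tangent nz, of 3 1 2] by simp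
  qed
  with L show thesis by (rule that)
qed

section \<open>Concurrent hyperosculating lines\<close>

lemma hyperosculating_form_point:
  assumes \<alpha>: "hyperosculating_form m \<alpha>" and P: "(\<Sum>n\<in>UNIV. \<alpha> n * P $ n) = 0"
  shows "(\<Sum>n\<in>UNIV. (P $ n) ^ 4) = (P $ m) ^ 4"
proof -
  obtain j k where mjk: "m \<noteq> j" "m \<noteq> k" "j \<noteq> k"
    by (rule obtain_complement_3)
  \<comment> \<open>Raising the first equation to the fourth power and inserting the second makes
    the j and k terms of the quartic cancel at P.\<close>
  have "\<alpha> j * P $ j = - (\<alpha> k * P $ k)" "\<alpha> j ^ 4 = - (\<alpha> k ^ 4)"
    using P \<alpha> by (simp_all add: sum_UNIV_distinct_3[OF mjk] hyperosculating_form_def add_eq_0_iff)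
  then have "\<alpha> k ^ 4 * ((P $ j) ^ 4 + (P $ k) ^ 4) = 0"
    by algebra
  then show ?thesis
    using \<alpha> mjk by (auto simp: sum_UNIV_distinct_3[OF mjk] hyperosculating_form_def)
qed

text \<open>Used in contrapositive form: different lines of a pencil have different slopes.\<close>

lemma hyperosculating_form_proportional:
  assumes \<alpha>: "hyperosculating_form i \<alpha>" and \<beta>: "hyperosculating_form i \<beta>"
    and ijk: "i \<noteq> j" "i \<noteq> k" "j \<noteq> k" and eq: "\<alpha> k * \<beta> j = \<beta> k * \<alpha> j"
  shows "zero_locus (linear_form \<alpha>) = zero_locus (linear_form \<beta>)"
proof -
  have nz: "\<alpha> j \<noteq> 0" "\<beta> j \<noteq> 0" "\<alpha> i = 0" "\<beta> i = 0"
    using \<alpha> \<beta> ijk by (auto simp: hyperosculating_form_def)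
  have "\<alpha> j * (\<beta> j * v + \<beta> k * w) = \<beta> j * (\<alpha> j * v + \<alpha> k * w)" for v w
    using eq by algebra
  then have "\<beta> j * v + \<beta> k * w = 0 \<longleftrightarrow> \<alpha> j * v + \<alpha> k * w = 0" for v w
    using nz by (metis mult_eq_0_iff)
  then show ?thesis
    using nz by (auto simp: zero_locus_linear_form sum_UNIV_distinct_3[OF ijk])
qed

text \<open>The two equations form an invertible linear system in the coordinates other than m, so
  the lines meet only in the coordinate point.\<close>

lemma hyperosculating_forms_common_point:
  assumes \<alpha>: "hyperosculating_form m \<alpha>" and \<beta>: "hyperosculating_form m \<beta>"
    and neq: "zero_locus (linear_form \<alpha>) \<noteq> zero_locus (linear_form \<beta>)"
    and P: "(\<Sum>n\<in>UNIV. \<alpha> n * P $ n) = 0" "(\<Sum>n\<in>UNIV. \<beta> n * P $ n) = 0" and "n \<noteq> m"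
  shows "P $ n = 0"
proof -
  obtain k where mnk: "m \<noteq> n" "m \<noteq> k" "n \<noteq> k"
    using \<open>n \<noteq> m\<close> by (metis obtain_complement_3)
  have "\<alpha> n * P $ n + \<alpha> k * P $ k = 0" "\<beta> n * P $ n + \<beta> k * P $ k = 0"
    using P \<alpha> \<beta> by (simp_all add: sum_UNIV_distinct_3[OF mnk] hyperosculating_form_def)
  then have "(\<alpha> k * \<beta> n - \<beta> k * \<alpha> n) * P $ n = 0"
    by algebra
  then show ?thesis
    using hyperosculating_form_proportional[OF \<alpha> \<beta> mnk] neq by auto
qed

text \<open>
  Writing \<open>\<sigma>\<close> for the sum of the \<open>P\<^sub>n\<^sup>4\<close>, each line through \<open>P\<close> gives \<open>\<sigma> = P\<^sub>m\<^sup>4\<close>.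
\<close>

lemma hyperosculating_forms_concurrent:
  assumes forms: "hyperosculating_form m1 \<alpha>1" "hyperosculating_form m2 \<alpha>2" "hyperosculating_form m3 \<alpha>3"
    and neq: "zero_locus (linear_form \<alpha>1) \<noteq> zero_locus (linear_form \<alpha>2)"
      "zero_locus (linear_form \<alpha>1) \<noteq> zero_locus (linear_form \<alpha>3)"
      "zero_locus (linear_form \<alpha>2) \<noteq> zero_locus (linear_form \<alpha>3)"
    and P: "P \<in> zero_locus (linear_form \<alpha>1)" "P \<in> zero_locus (linear_form \<alpha>2)"
      "P \<in> zero_locus (linear_form \<alpha>3)"
  shows "m1 = m2 \<and> m1 = m3"
proof -
  define \<sigma> where "\<sigma> = (\<Sum>n\<in>UNIV. (P $ n) ^ 4)"
  have P0: "P \<noteq> 0"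
    and on: "(\<Sum>n\<in>UNIV. \<alpha>1 n * P $ n) = 0" "(\<Sum>n\<in>UNIV. \<alpha>2 n * P $ n) = 0"
      "(\<Sum>n\<in>UNIV. \<alpha>3 n * P $ n) = 0"
    using P by (simp_all add: zero_locus_linear_form)
  have \<sigma>: "\<sigma> = (P $ m1) ^ 4" "\<sigma> = (P $ m2) ^ 4" "\<sigma> = (P $ m3) ^ 4"
    using forms on hyperosculating_form_point unfolding \<sigma>_def by blast+
  \<comment> \<open>Two lines of one pencil meet in its coordinate point m, where \<sigma> is the
    fourth power of the only nonzero coordinate. A third line from another pencil would give
    \<sigma> = 0.\<close>
  have "\<sigma> \<noteq> 0" if "m1 = m2 \<or> m1 = m3 \<or> m2 = m3"
  proof
    assume "\<sigma> = 0"
    then have "P $ n = 0" for n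
      using that forms neq on \<sigma> hyperosculating_forms_common_point[of _ _ _ P n]
      by (metis power_eq_0_iff)
    then show False using P0 by (simp add: vec_eq_iff)
  qed
  moreover have "\<sigma> = 0" if "m1 = m2" "m3 \<noteq> m1"
    using hyperosculating_forms_common_point[OF forms(1) _ neq(1) on(1,2) that(2)] that(1) forms(2) \<sigma>(3) by simp
  moreover have "\<sigma> = 0" if "m1 = m3" "m2 \<noteq> m1"
    using hyperosculating_forms_common_point[OF forms(1) _ neq(2) on(1,3) that(2)] that(1) forms(3) \<sigma>(2) by simp
  moreover have "\<sigma> = 0" if "m2 = m3" "m1 \<noteq> m2"
    using hyperosculating_forms_common_point[OF forms(2) _ neq(3) on(2,3) that(2)] that(1) forms(3) \<sigma>(1) by simp
  moreover have "m1 = m2 \<or> m1 = m3 \<or> m2 = m3"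
  proof (rule ccontr)
    assume "\<not> ?thesis"
    then have m: "m1 \<noteq> m2" "m1 \<noteq> m3" "m2 \<noteq> m3" by auto
    \<comment> \<open>With three different pencils each summand of \<sigma> equals \<sigma>
      itself.\<close>
    then have "\<sigma> = \<sigma> + \<sigma> + \<sigma>"
      using \<sigma> sum_UNIV_distinct_3[OF m, of "\<lambda>n. (P $ n) ^ 4"] unfolding \<sigma>_def[symmetric] by simp
    then have "\<sigma> = 0"
      by simp
    then have "(P $ m1) = 0" "P $ m2 = 0" "P $ m3 = 0"
      using \<sigma> by auto
    moreover have "n = m1 \<or> n = m2 \<or> n = m3" for n
      using m by (metis exhaust_3)
    ultimately have "P $ n = 0" for n
      by metis
    then show False using P0 by (simp add: vec_eq_iff)
  qed
  ultimately show ?thesis by metis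
qed

text \<open>The divided differences of T^4 + 1 over two and over three of its roots vanish. They are
  the complete symmetric polynomials of degrees 3 and 2, from which the elementary symmetric
  functions of all four roots follow.\<close>

lemma fourth_roots_of_minus_one:
  fixes t1 t2 t3 :: complex
  assumes t: "t1 ^ 4 = - 1" "t2 ^ 4 = - 1" "t3 ^ 4 = - 1" and neq: "t1 \<noteq> t2" "t1 \<noteq> t3" "t2 \<noteq> t3"
  defines "t4 \<equiv> - (t1 + t2 + t3)"
  shows "distinct [t1, t2, t3, t4]"
    and "t1 + t2 + t3 + t4 = 0"
    and "t1 * t2 + t1 * t3 + t1 * t4 + t2 * t3 + t2 * t4 + t3 * t4 = 0"
    and "t1 * t2 * t3 + t1 * t2 * t4 + t1 * t3 * t4 + t2 * t3 * t4 = 0"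
    and "t1 * t2 * t3 * t4 = 1"
proof -
  have "(t1 - t2) * (t1 ^ 3 + t1 ^ 2 * t2 + t1 * t2 ^ 2 + t2 ^ 3) = t1 ^ 4 - t2 ^ 4"
    "(t1 - t3) * (t1 ^ 3 + t1 ^ 2 * t3 + t1 * t3 ^ 2 + t3 ^ 3) = t1 ^ 4 - t3 ^ 4"
    by algebra+
  then have h3: "t1 ^ 3 + t1 ^ 2 * t2 + t1 * t2 ^ 2 + t2 ^ 3 = 0"
    "t1 ^ 3 + t1 ^ 2 * t3 + t1 * t3 ^ 2 + t3 ^ 3 = 0"
    using t neq by simp_all
  have "(t2 - t3) * (t1 ^ 2 + t2 ^ 2 + t3 ^ 2 + t1 * t2 + t1 * t3 + t2 * t3)
     = (t1 ^ 3 + t1 ^ 2 * t2 + t1 * t2 ^ 2 + t2 ^ 3) - (t1 ^ 3 + t1 ^ 2 * t3 + t1 * t3 ^ 2 + t3 ^ 3)"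
    by algebra
  then have h2: "t1 ^ 2 + t2 ^ 2 + t3 ^ 2 + t1 * t2 + t1 * t3 + t2 * t3 = 0"
    using h3 neq by simp
  show e1: "t1 + t2 + t3 + t4 = 0"
    by (simp add: t4_def)
  show e2: "t1 * t2 + t1 * t3 + t1 * t4 + t2 * t3 + t2 * t4 + t3 * t4 = 0"
    using h2 unfolding t4_def by algebra
  show e3: "t1 * t2 * t3 + t1 * t2 * t4 + t1 * t3 * t4 + t2 * t3 * t4 = 0"
    using h2 h3(1) unfolding t4_def by algebra
  \<comment> \<open>With the first three symmetric functions zero, the monic quartic with these
    roots is T^4 + t1 t2 t3 t4; its value at t1 is zero.\<close>
  have e4: "t1 ^ 4 + t1 * t2 * t3 * t4 = 0"
    using e1 e2 e3 by algebra
  then show "t1 * t2 * t3 * t4 = 1"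
    using t(1) by simp
  have nz: "t1 \<noteq> 0" "t2 \<noteq> 0" "t3 \<noteq> 0"
    using t by auto
  \<comment> \<open>A repeated root p of a quartic T^4 + const is a zero of the derivative 4
    T^3.\<close>
  have double_root: "p = 0"
    if "p + q + r + p = 0" "p * q + p * r + p * p + q * r + q * p + r * p = 0"
      "p * q * r + p * q * p + p * r * p + q * r * p = 0" for p q r :: complex
  proof -
    have "4 * p ^ 3 = (p * q * r + p * q * p + p * r * p + q * r * p)
        - 2 * p * (p * q + p * r + p * p + q * r + q * p + r * p) + 3 * p ^ 2 * (p + q + r + p)"
      by algebra
    then show ?thesis unfolding that by simp
  qed
  have "t4 \<noteq> t1" "t4 \<noteq> t2" "t4 \<noteq> t3"
    using double_root[of t1 t2 t3] double_root[of t2 t1 t3] double_root[of t3 t1 t2] nz e1 e2 e3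
    by (auto simp: ac_simps)
  then show "distinct [t1, t2, t3, t4]"
    using neq by auto
qed

theorem proposition4p6:
  fixes L1 L2 L3 :: S
  assumes "hyperosculating dyck_quartic L1"
    and "hyperosculating dyck_quartic L2"
    and "hyperosculating dyck_quartic L3"
    and "zero_locus L1 \<noteq> zero_locus L2"
    and "zero_locus L1 \<noteq> zero_locus L3"
    and "zero_locus L2 \<noteq> zero_locus L3"
    and "\<exists>P \<in> zero_locus L1 \<inter> zero_locus L2 \<inter> zero_locus L3.
           ordinary_triple_point (arrangement_curve [dyck_quartic, L1, L2, L3]) P"
  shows "plus_one_generated_arrangement [dyck_quartic, L1, L2, L3]"
proof -
  obtain i \<alpha>1 where L1: "L1 = linear_form \<alpha>1" and \<alpha>1: "hyperosculating_form i \<alpha>1"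
    using assms(1) by (rule hyperosculating_dyck_quartic)
  obtain i2 \<alpha>2 where L2: "L2 = linear_form \<alpha>2" and "hyperosculating_form i2 \<alpha>2"
    using assms(2) by (rule hyperosculating_dyck_quartic)
  moreover obtain i3 \<alpha>3 where L3: "L3 = linear_form \<alpha>3" and "hyperosculating_form i3 \<alpha>3"
    using assms(3) by (rule hyperosculating_dyck_quartic)
  ultimately have \<alpha>2: "hyperosculating_form i \<alpha>2" and \<alpha>3: "hyperosculating_form i \<alpha>3"
    using hyperosculating_forms_concurrent[OF \<alpha>1] assms(4-7) L1 by blast+
  obtain j k where ijk: "i \<noteq> j" "i \<noteq> k" "j \<noteq> k"
    by (rule obtain_complement_3)
  define t where "t \<alpha> = \<alpha> k / \<alpha> j" for \<alpha> :: "3 \<Rightarrow> complex"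
  have j0: "\<alpha>1 j \<noteq> 0" "\<alpha>2 j \<noteq> 0" "\<alpha>3 j \<noteq> 0"
    using \<alpha>1 \<alpha>2 \<alpha>3 ijk by (auto simp: hyperosculating_form_def)
  have t4: "t \<alpha> ^ 4 = - 1" if "hyperosculating_form i \<alpha>" for \<alpha>
  proof -
    have "\<alpha> j \<noteq> 0" "\<alpha> j ^ 4 + \<alpha> k ^ 4 = 0"
      using that ijk by (auto simp: hyperosculating_form_def sum_UNIV_distinct_3[OF ijk])
    then show ?thesis by (simp add: t_def field_simps add_eq_0_iff)
  qed
  have "t \<alpha>1 \<noteq> t \<alpha>2" "t \<alpha>1 \<noteq> t \<alpha>3" "t \<alpha>2 \<noteq> t \<alpha>3"
    using assms(4-6) hyperosculating_form_proportional[OF \<alpha>1 \<alpha>2 ijk]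
      hyperosculating_form_proportional[OF \<alpha>1 \<alpha>3 ijk] hyperosculating_form_proportional[OF \<alpha>2 \<alpha>3 ijk]
      j0 unfolding L1 L2 L3 by (auto simp: t_def field_simps)
  note roots = fourth_roots_of_minus_one[OF t4[OF \<alpha>1] t4[OF \<alpha>2] t4[OF \<alpha>3] this]
  define s where "s = - (t \<alpha>1 + t \<alpha>2 + t \<alpha>3)"
  \<comment> \<open>This scale makes the product of the four scales 1, so that \<open>c * l\<close>
    is y^4 + z^4 and not just a multiple of it.\<close>
  define a where "a = inverse (\<alpha>1 j * \<alpha>2 j * \<alpha>3 j)"
  interpret concurrent_lines i j k "\<alpha>1 j" "\<alpha>2 j" "\<alpha>3 j" a "t \<alpha>1" "t \<alpha>2" "t \<alpha>3" s
    using ijk j0 roots(1) by unfold_locales (simp_all add: a_def s_def)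
  have L: "linear_form \<alpha> = form (\<alpha> j) (t \<alpha>)" if "hyperosculating_form i \<alpha>" for \<alpha>
  proof -
    have "\<alpha> i = 0" "\<alpha> j \<noteq> 0"
      using that ijk by (auto simp: hyperosculating_form_def)
    then have "\<alpha> k = \<alpha> j * t \<alpha>" by (simp add: t_def)
    then have "Const (\<alpha> k) = Const (\<alpha> j) * Const (t \<alpha>)" by (simp add: mult_single)
    then show ?thesis
      using \<open>\<alpha> i = 0\<close>
      by (simp add: linear_form_def sum_UNIV_distinct_3[OF ijk] form_def y_def z_def algebra_simps)
  qed
  have scale: "\<alpha>1 j * \<alpha>2 j * \<alpha>3 j * a = 1"
    unfolding a_def using j0 by (intro right_inverse) simp
  let ?C = Const
  \<comment> \<open>The scalar relations are moved into S, so that the expansion of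
    \<open>c * l\<close> becomes a formal identity in the constants.\<close>
  have T: "?C (t \<alpha>1) + ?C (t \<alpha>2) + ?C (t \<alpha>3) + ?C s = 0"
    "?C (t \<alpha>1) * ?C (t \<alpha>2) + ?C (t \<alpha>1) * ?C (t \<alpha>3) + ?C (t \<alpha>1) * ?C s
      + ?C (t \<alpha>2) * ?C (t \<alpha>3) + ?C (t \<alpha>2) * ?C s + ?C (t \<alpha>3) * ?C s = 0"
    "?C (t \<alpha>1) * ?C (t \<alpha>2) * ?C (t \<alpha>3) + ?C (t \<alpha>1) * ?C (t \<alpha>2) * ?C s
      + ?C (t \<alpha>1) * ?C (t \<alpha>3) * ?C s + ?C (t \<alpha>2) * ?C (t \<alpha>3) * ?C s = 0"
    "?C (t \<alpha>1) * ?C (t \<alpha>2) * ?C (t \<alpha>3) * ?C s = 1"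
    "?C (\<alpha>1 j) * ?C (\<alpha>2 j) * ?C (\<alpha>3 j) * ?C a = 1"
    using roots(2-5)[folded s_def] scale
    by (simp_all add: mult_single flip: single_add)
  have "c * l = (?C (\<alpha>1 j) * ?C (\<alpha>2 j) * ?C (\<alpha>3 j) * ?C a)
      * (y ^ 4 + (?C (t \<alpha>1) + ?C (t \<alpha>2) + ?C (t \<alpha>3) + ?C s) * y ^ 3 * z
        + (?C (t \<alpha>1) * ?C (t \<alpha>2) + ?C (t \<alpha>1) * ?C (t \<alpha>3) + ?C (t \<alpha>1) * ?C s
          + ?C (t \<alpha>2) * ?C (t \<alpha>3) + ?C (t \<alpha>2) * ?C s + ?C (t \<alpha>3) * ?C s) * y ^ 2 * z ^ 2
        + (?C (t \<alpha>1) * ?C (t \<alpha>2) * ?C (t \<alpha>3) + ?C (t \<alpha>1) * ?C (t \<alpha>2) * ?C s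
          + ?C (t \<alpha>1) * ?C (t \<alpha>3) * ?C s + ?C (t \<alpha>2) * ?C (t \<alpha>3) * ?C s) * y * z ^ 3
        + (?C (t \<alpha>1) * ?C (t \<alpha>2) * ?C (t \<alpha>3) * ?C s) * z ^ 4)"
    unfolding c_def l_def form_def by algebra
  then have "c * l = y ^ 4 + z ^ 4"
    unfolding T by simp
  then have "dyck_quartic = x ^ 4 + c * l"
    by (simp add: dyck_quartic_eq sum_UNIV_distinct_3[OF ijk] x_def y_def z_def add.assoc)
  then have "arrangement_curve [dyck_quartic, L1, L2, L3] = f"
    by (simp add: arrangement_curve_def f_def c_def L1 L2 L3 L \<alpha>1 \<alpha>2 \<alpha>3 mult.assoc)
  then show ?thesis
    using plus_one_generated_f by (simp add: plus_one_generated_arrangement_def)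
qed

end
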